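(* For every $n\ge1$: (1) $\operatorname{Proj}^-_{\mathbb{R}^n}\le_{\mathrm{sW}}\operatorname{BWT}_\mathbb{R}$ and $\operatorname{Proj}^+_{\mathbb{R}^n}\le_{\mathrm{sW}}\operatorname{BWT}_\mathbb{R}$; (2) $\operatorname{Proj}_{\mathbb{R}^n}\le_{\mathrm{sW}}\operatorname{WKL}$.
   Context: Represented spaces: a representation of a set $X$ is a partial surjection $\delta_X:\subseteq\mathbb{N}^\mathbb{N}\to X$. For a partial multi-valued function $f:\subseteq X\rightrightarrows Y$, a realizer is a partial $F:\subseteq\mathbb{N}^\mathbb{N}\to\mathbb{N}^\mathbb{N}$ with $\delta_Y(F(p))\in f(\delta_X(p))$ for all $p$ with $\delta_X(p)\in\mathrm{dom}(f)$. Strong Weihrauch reducibility $f\le_{\mathrm{sW}}g$: there are computable partial $H,K:\subseteq\mathbb{N}^\mathbb{N}\to\mathbb{N}^\mathbb{N}$ with $H\circ G\circ K$ a realizer of $f$ for every realizer $G$ of $g$. $\mathbb{R}^n$ has the Euclidean metric and the Cauchy representation (names are sequences $(q_i)$ in $\mathbb{Q}^n$ with $d(q_i,q_j)\le2^{-i}$ for $j\ge i$, naming the limit). Basic balls are open balls $B(c,r)$ with $c\in\mathbb{Q}^n$, $r$ a nonnegative rational. Closed sets: $\mathcal{A}_-(\mathbb{R}^n)$ (negative information): a name of closed $A$ enumerates basic balls whose union is $\mathbb{R}^n\setminus A$; $\mathcal{A}_+(\mathbb{R}^n)$ (positive information): a name enumerates exactly the basic balls meeting $A$; $\mathcal{A}(\mathbb{R}^n)$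 (total information): a pair of a negative and a positive name. For $x\in\mathbb{R}^n$ and nonempty closed $A$, a projection point of $x$ onto $A$ is $y\in A$ with $d(x,y)=d(x,A)$. $\operatorname{Proj}^-_{\mathbb{R}^n}$, $\operatorname{Proj}^+_{\mathbb{R}^n}$, $\operatorname{Proj}_{\mathbb{R}^n}$ are the multi-valued maps with inputs $(x,A)\in\mathbb{R}^n\times\mathcal{A}_-(\mathbb{R}^n)$, resp. $\mathbb{R}^n\times\mathcal{A}_+(\mathbb{R}^n)$, resp. $\mathbb{R}^n\times\mathcal{A}(\mathbb{R}^n)$, with $A\ne\emptyset$, outputting any projection point of $x$ onto $A$. $\operatorname{BWT}_\mathbb{R}:\subseteq\mathbb{R}^\mathbb{N}\rightrightarrows\mathbb{R}$ maps each sequence of reals with bounded (relatively compact) range to the set of its cluster points. $\operatorname{WKL}$ maps each infinite binary tree $T\subseteq 2^{<\mathbb{N}}$ (given by its characteristic function w.r.t. a fixed computable enumeration of $2^{<\mathbb{N}}$) to the set of its infinite paths in $2^\mathbb{N}$. *)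

theory Defs
  imports "HOL-Analysis.Analysis" "HOL-Library.Nat_Bijection"
begin

text \<open>Partial functions on tuples of naturals are modelled as functions
  nat list => nat option; recfn k f means f is a partial recursive function
  of arity k (only its behaviour on lists of length k matters).\<close>

fun prim_rec_op ::
  "(nat list \<Rightarrow> nat option) \<Rightarrow> (nat list \<Rightarrow> nat option) \<Rightarrow> nat \<Rightarrow> nat list \<Rightarrow> nat option"
where
  "prim_rec_op g h 0 ys = g ys"
| "prim_rec_op g h (Suc k) ys = Option.bind (prim_rec_op g h k ys) (\<lambda>r. h (k # r # ys))"

inductive recfn :: "nat \<Rightarrow> (nat list \<Rightarrow> nat option) \<Rightarrow> bool" where
  rf_zero: "recfn 0 (\<lambda>_. Some 0)"
| rf_succ: "recfn 1 (\<lambda>xs. Some (Suc (hd xs)))"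
| rf_proj: "i < n \<Longrightarrow> recfn n (\<lambda>xs. Some (xs ! i))"
| rf_comp: "recfn m g \<Longrightarrow> length fs = m \<Longrightarrow> (\<forall>f\<in>set fs. recfn n f) \<Longrightarrow>
    recfn n (\<lambda>xs. if (\<forall>f\<in>set fs. f xs \<noteq> None) then g (map (\<lambda>f. the (f xs)) fs) else None)"
| rf_prim: "recfn n g \<Longrightarrow> recfn (Suc (Suc n)) h \<Longrightarrow>
    recfn (Suc n) (\<lambda>xs. prim_rec_op g h (hd xs) (tl xs))"
| rf_mu: "recfn (Suc n) f \<Longrightarrow>
    recfn n (\<lambda>xs. if (\<exists>y. f (y # xs) = Some 0 \<and> (\<forall>z<y. f (z # xs) \<noteq> None))
                   then Some (LEAST y. f (y # xs) = Some 0 \<and> (\<forall>z<y. f (z # xs) \<noteq> None))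
                   else None)"

type_synonym baire = "nat \<Rightarrow> nat"

definition prefix_code :: "baire \<Rightarrow> nat \<Rightarrow> nat" where
  "prefix_code p n = list_encode (map p [0..<n])"

text \<open>A partial function F on Baire space (F p = None: undefined) is computable
  iff some partial recursive psi, given (a code of) a finite prefix of the input
  and an output position i, produces only correct values of the i-th output
  symbol and produces one for some finite prefix of every input in dom F.
  This is equivalent to computability by a Type-2 machine.\<close>
definition computable_partial :: "(baire \<Rightarrow> baire option) \<Rightarrow> bool" where
  "computable_partial F \<longleftrightarrow> (\<exists>\<psi>. recfn 2 \<psi> \<and>
     (\<forall>p q. F p = Some q \<longrightarrow>
        (\<forall>i. (\<exists>n. \<psi> [prefix_code p n, i] \<noteq> None) \<and>
             (\<forall>n v. \<psi> [prefix_code p n, i] = Some v \<longrightarrow> v = q i))))"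

text \<open>A representation of X is a partial map delta : baire => X option.
  A partial multi-valued function f :\<subseteq> X \<rightrightarrows> Y is given by its domain D and
  its value sets f x.\<close>

definition is_realizer ::
  "(baire \<Rightarrow> 'x option) \<Rightarrow> (baire \<Rightarrow> 'y option) \<Rightarrow> 'x set \<Rightarrow> ('x \<Rightarrow> 'y set)
    \<Rightarrow> (baire \<Rightarrow> baire option) \<Rightarrow> bool" where
  "is_realizer \<delta>X \<delta>Y D f G \<longleftrightarrow>
     (\<forall>p x. \<delta>X p = Some x \<longrightarrow> x \<in> D \<longrightarrow>
        (\<exists>q y. G p = Some q \<and> \<delta>Y q = Some y \<and> y \<in> f x))"

definition strong_weihrauch_le ::
  "(baire \<Rightarrow> 'x option) \<Rightarrow> (baire \<Rightarrow> 'y option) \<Rightarrow> 'x set \<Rightarrow> ('x \<Rightarrow> 'y set) \<Rightarrow>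
   (baire \<Rightarrow> 'u option) \<Rightarrow> (baire \<Rightarrow> 'v option) \<Rightarrow> 'u set \<Rightarrow> ('u \<Rightarrow> 'v set) \<Rightarrow> bool" where
  "strong_weihrauch_le \<delta>X \<delta>Y Df f \<delta>U \<delta>V Dg g \<longleftrightarrow>
     (\<exists>H K. computable_partial H \<and> computable_partial K \<and>
        (\<forall>G. is_realizer \<delta>U \<delta>V Dg g G \<longrightarrow>
             is_realizer \<delta>X \<delta>Y Df f (\<lambda>p. Option.bind (K p) (\<lambda>r. Option.bind (G r) H))))"

definition pair_rep :: "(baire \<Rightarrow> 'a option) \<Rightarrow> (baire \<Rightarrow> 'b option) \<Rightarrow> baire \<Rightarrow> ('a \<times> 'b) option" where
  "pair_rep \<delta>1 \<delta>2 r = (case (\<delta>1 (\<lambda>i. r (2 * i)), \<delta>2 (\<lambda>i. r (2 * i + 1))) of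
       (Some a, Some b) \<Rightarrow> Some (a, b) | _ \<Rightarrow> None)"

definition seq_rep :: "(baire \<Rightarrow> 'a option) \<Rightarrow> baire \<Rightarrow> (nat \<Rightarrow> 'a) option" where
  "seq_rep \<delta> r = (if (\<forall>i. \<delta> (\<lambda>j. r (prod_encode (i, j))) \<noteq> None)
                   then Some (\<lambda>i. the (\<delta> (\<lambda>j. r (prod_encode (i, j))))) else None)"

definition rat_of_code :: "nat \<Rightarrow> rat" where
  "rat_of_code c = (case prod_decode c of (a, b) \<Rightarrow> of_int (int_decode a) / of_nat (Suc b))"

definition ratvec_of_code :: "nat \<Rightarrow> real ^ 'n::enum" where
  "ratvec_of_code c = (\<chi> j. case map_of (zip Enum.enum (list_decode c)) j of
                              None \<Rightarrow> 0 | Some k \<Rightarrow> real_of_rat (rat_of_code k))"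

definition cauchy_rep :: "(nat \<Rightarrow> 'a::metric_space) \<Rightarrow> baire \<Rightarrow> 'a option" where
  "cauchy_rep \<alpha> p = (if (\<forall>i j. i \<le> j \<longrightarrow> dist (\<alpha> (p i)) (\<alpha> (p j)) \<le> (1/2) ^ i)
                      then Some (lim (\<lambda>i. \<alpha> (p i))) else None)"

definition rho_R :: "baire \<Rightarrow> real option" where
  "rho_R = cauchy_rep (\<lambda>c. real_of_rat (rat_of_code c))"

definition rho_Rn :: "baire \<Rightarrow> (real ^ 'n::enum) option" where
  "rho_Rn = cauchy_rep ratvec_of_code"

definition basic_ball :: "nat \<Rightarrow> (real ^ 'n::enum) set" where
  "basic_ball c = (case prod_decode c of (a, b) \<Rightarrow>
                     ball (ratvec_of_code a) (real_of_rat \<bar>rat_of_code b\<bar>))"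

definition neg_rep :: "baire \<Rightarrow> (real ^ 'n::enum) set option" where
  "neg_rep p = Some (- (\<Union>i. basic_ball (p i)))"

definition pos_name :: "baire \<Rightarrow> (real ^ 'n::enum) set \<Rightarrow> bool" where
  "pos_name p A \<longleftrightarrow> closed A \<and> range p = {c. basic_ball c \<inter> A \<noteq> {}}"

definition pos_rep :: "baire \<Rightarrow> (real ^ 'n::enum) set option" where
  "pos_rep p = (if (\<exists>A::(real ^ 'n::enum) set. pos_name p A) then Some (SOME A. pos_name p A) else None)"

definition total_rep :: "baire \<Rightarrow> (real ^ 'n::enum) set option" where
  "total_rep r = (case pair_rep neg_rep pos_rep r of
                    Some (A, B) \<Rightarrow> (if A = B then Some A else None) | None \<Rightarrow> None)"

definition proj_dom :: "((real ^ 'n::enum) \<times> (real ^ 'n::enum) set) set" where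
  "proj_dom = {(x, A). A \<noteq> {}}"

definition proj_points :: "(real ^ 'n::enum) \<times> (real ^ 'n::enum) set \<Rightarrow> (real ^ 'n::enum) set" where
  "proj_points xA = (case xA of (x, A) \<Rightarrow> {y \<in> A. dist x y = infdist x A})"

definition cluster_point :: "(nat \<Rightarrow> real) \<Rightarrow> real \<Rightarrow> bool" where
  "cluster_point s x \<longleftrightarrow> (\<forall>e>0. \<exists>\<^sub>\<infinity>n. dist (s n) x < e)"

definition BWT_dom :: "(nat \<Rightarrow> real) set" where
  "BWT_dom = {s. bounded (range s)}"

definition BWT_val :: "(nat \<Rightarrow> real) \<Rightarrow> real set" where
  "BWT_val s = {x. cluster_point s x}"

definition bword :: "nat \<Rightarrow> bool list" where
  "bword k = map (\<lambda>m. m \<noteq> 0) (list_decode k)"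

definition is_tree :: "bool list set \<Rightarrow> bool" where
  "is_tree T \<longleftrightarrow> (\<forall>w v. w @ v \<in> T \<longrightarrow> w \<in> T)"

definition tree_rep :: "baire \<Rightarrow> bool list set option" where
  "tree_rep p = (if (\<forall>k. p k \<le> 1) \<and> (\<forall>k k'. bword k = bword k' \<longrightarrow> p k = p k') \<and>
                    is_tree {bword k | k. p k = 1}
                 then Some {bword k | k. p k = 1} else None)"

definition cantor_rep :: "baire \<Rightarrow> (nat \<Rightarrow> bool) option" where
  "cantor_rep p = (if (\<forall>k. p k \<le> 1) then Some (\<lambda>k. p k = 1) else None)"

definition WKL_dom :: "bool list set set" where
  "WKL_dom = {T. is_tree T \<and> infinite T}"

definition WKL_val :: "bool list set \<Rightarrow> (nat \<Rightarrow> bool) set" where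
  "WKL_val T = {f. \<forall>n. map f [0..<n] \<in> T}"

end

theory Submission
  imports Defs "HOL-Library.Discrete_Functions"
begin

text \<open>
  All three reductions produce names in unary: a sequence \<open>u\<close> of codes of rational vectors is
  written as the binary sequence \<open>1\<^bsup>u 0\<^esup> 0 1\<^bsup>u 1\<^esup> 0 \<dots>\<close>, from which a machine reads off \<open>u\<close> without any
  further information on the input.

  For negative or positive information there is a computable sequence of rational vectors
  that is bounded and all of whose cluster points are projection points: at stage \<open>k\<close> one minimises
  the distance to \<open>x\<close> over a finite net outside the removed balls, respectively
  \<open>d(x, c) + 2 r\<close> over the balls enumerated so far. Rounding its members to precision \<open>2 ^ (- m)\<close> for
  all \<open>m\<close>, writing the result in unary and reading the bits as base 4 digits gives
  a bounded sequence of reals; since the digits 0 and 1 leave gaps, a cluster point determines its bits.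

  For total information the projection points form an effectively closed set: \<open>y\<close> lies
  outside all removed balls, and \<open>d(x, y) \<le> d(x, c) + r\<close> for every ball meeting \<open>A\<close>. The unary words
  that are not yet refuted form a tree, and bounding the blocks of ones keeps its paths decodable.
\<close>

subsection \<open>Computable functionals\<close>

text \<open>Strength shapes the reductions: the final decoding sees the solver's answer but not
  \<open>(x, A)\<close>, so the answer alone must carry a complete name of a projection point, all
  coordinates included. A name is a sequence of unbounded naturals, whereas a cluster point or a
  path offers bits; hence the unary coding. The danger is a limit of unary codings that ends in ones
  forever. Compactness averts it: rounded vectors are written with the fixed denominator
  \<open>2 ^ l\<close>, so at each precision the codes of a bounded set of vectors are bounded,
  uniformly in the stage. No test ever compares reals. Distances are scaled by a power of 2 and
  rounded to naturals, with an error that depends on the dimension only. Each test gets a tolerance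
  that lets every good approximation of a projection point pass; what passes wrongly is off by a
  constant times \<open>2 ^ (- m)\<close>, which vanishes in the limit. The constants therefore come
  in pairs, one for acceptance and a larger one for the error after acceptance.\<close>

text \<open>Here \<open>E p n\<close> is the \<open>n\<close>-th finite piece of information on \<open>p\<close>: a program may be undefined while
  \<open>n\<close> is small but must settle eventually, which makes the class closed under composition.\<close>

definition realizes ::
  "('p \<Rightarrow> nat \<Rightarrow> nat) \<Rightarrow> 'p set \<Rightarrow> nat \<Rightarrow> (nat list \<Rightarrow> nat option) \<Rightarrow> ('p \<Rightarrow> nat list \<Rightarrow> nat) \<Rightarrow> bool" where
  "realizes E D m \<psi> F \<longleftrightarrow> recfn (Suc m) \<psi> \<and> (\<forall>p\<in>D. \<forall>xs. length xs = m \<longrightarrow>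
     (\<forall>n. \<psi> (E p n # xs) \<in> {None, Some (F p xs)}) \<and>
     (\<forall>\<^sub>F n in sequentially. \<psi> (E p n # xs) = Some (F p xs)))"

definition comp_rel ::
  "('p \<Rightarrow> nat \<Rightarrow> nat) \<Rightarrow> 'p set \<Rightarrow> nat \<Rightarrow> ('p \<Rightarrow> nat list \<Rightarrow> nat) \<Rightarrow> bool" where
  "comp_rel E D m F \<longleftrightarrow> (\<exists>\<psi>. realizes E D m \<psi> F)"

named_theorems cr_intros

lemma comp_rel_cong:
  assumes "comp_rel E D m F" "\<And>p xs. p \<in> D \<Longrightarrow> length xs = m \<Longrightarrow> F p xs = F' p xs"
  shows "comp_rel E D m F'"
proof -
  obtain \<psi> where "realizes E D m \<psi> F" using assms(1) by (auto simp: comp_rel_def)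
  then have "realizes E D m \<psi> F'" using assms(2) by (simp add: realizes_def)
  then show ?thesis by (auto simp: comp_rel_def)
qed

text \<open>Composition with projections; it supplies the permutations of arguments that the fixed
  argument order of \<open>rf_prim\<close> and \<open>rf_mu\<close> makes necessary.\<close>

lemma recfn_reindex:
  assumes "recfn k \<psi>" "length js = k" "\<And>i. i \<in> set js \<Longrightarrow> i < n"
  shows "recfn n (\<lambda>ys. \<psi> (map (\<lambda>i. ys ! i) js))"
proof -
  have "recfn n (\<lambda>xs. if (\<forall>f\<in>set (map (\<lambda>i xs. Some (xs ! i)) js). f xs \<noteq> None)
     then \<psi> (map (\<lambda>f. the (f xs)) (map (\<lambda>i xs. Some (xs ! i)) js)) else None)"
    by (rule rf_comp[OF assms(1)]) (use assms in \<open>auto intro: rf_proj\<close>)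
  then show ?thesis by (simp add: comp_def)
qed

text \<open>All parts work on the same finite piece of information: a missing answer of any part
  makes the whole undefined, and finitely many parts that settle eventually have all settled from
  some \<open>n\<close> on.\<close>

lemma comp_rel_comp:
  assumes g: "comp_rel E D k g" and k: "length fs = k"
    and fs: "\<And>f. f \<in> set fs \<Longrightarrow> comp_rel E D m f"
  shows "comp_rel E D m (\<lambda>p xs. g p (map (\<lambda>f. f p xs) fs))"
proof -
  obtain \<psi> where \<psi>: "realizes E D k \<psi> g" using g by (auto simp: comp_rel_def)
  have "\<forall>f\<in>set fs. \<exists>\<phi>. realizes E D m \<phi> f" using fs by (auto simp: comp_rel_def)
  then obtain \<Phi> where \<Phi>: "\<And>f. f \<in> set fs \<Longrightarrow> realizes E D m (\<Phi> f) f" by metis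
  \<comment> \<open>The extra first entry hands the piece of information itself on to
    \<open>\<psi>\<close>.\<close>
  define hs where "hs = (\<lambda>ys. Some (ys ! 0)) # map \<Phi> fs"
  define \<theta> where "\<theta> = (\<lambda>ys. if (\<forall>f\<in>set hs. f ys \<noteq> None) then \<psi> (map (\<lambda>f. the (f ys)) hs) else None)"
  have "recfn (Suc m) \<theta>" unfolding \<theta>_def
  proof (rule rf_comp)
    show "recfn (Suc k) \<psi>" using \<psi> by (simp add: realizes_def)
    show "\<forall>f\<in>set hs. recfn (Suc m) f" using \<Phi> by (auto simp: hs_def realizes_def rf_proj)
  qed (simp add: hs_def k)
  moreover have "(\<forall>n. \<theta> (E p n # xs) \<in> {None, Some (g p (map (\<lambda>f. f p xs) fs))}) \<and>
     (\<forall>\<^sub>F n in sequentially. \<theta> (E p n # xs) = Some (g p (map (\<lambda>f. f p xs) fs)))"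
    if p: "p \<in> D" and xs: "length xs = m" for p xs
  proof -
    have eq: "\<theta> (E p n # xs) = \<psi> (E p n # map (\<lambda>f. f p xs) fs)"
      if "\<forall>f\<in>set fs. \<Phi> f (E p n # xs) = Some (f p xs)" for n
    proof -
      have "map (\<lambda>f. the (\<Phi> f (E p n # xs))) fs = map (\<lambda>f. f p xs) fs"
        using that by auto
      then show ?thesis using that by (simp add: \<theta>_def hs_def comp_def del: map_eq_conv)
    qed
    have \<psi>1: "\<psi> (E p n # map (\<lambda>f. f p xs) fs) \<in> {None, Some (g p (map (\<lambda>f. f p xs) fs))}" for n
      using \<psi> p k by (simp add: realizes_def)
    have "\<theta> (E p n # xs) \<in> {None, Some (g p (map (\<lambda>f. f p xs) fs))}" for n
    proof (cases "\<forall>f\<in>set fs. \<Phi> f (E p n # xs) = Some (f p xs)")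
      case True
      then show ?thesis using eq \<psi>1 by simp
    next
      case False
      then obtain f where "f \<in> set fs" "\<Phi> f (E p n # xs) = None"
        using \<Phi> p xs unfolding realizes_def by blast
      then show ?thesis by (auto simp: \<theta>_def hs_def)
    qed
    moreover have "\<forall>\<^sub>F n in sequentially. \<forall>f\<in>set fs. \<Phi> f (E p n # xs) = Some (f p xs)"
      using \<Phi> p xs by (auto simp: realizes_def eventually_ball_finite_distrib)
    moreover have "\<forall>\<^sub>F n in sequentially. \<psi> (E p n # map (\<lambda>f. f p xs) fs) = Some (g p (map (\<lambda>f. f p xs) fs))"
      using \<psi> p k by (simp add: realizes_def)
    ultimately show ?thesis
    proof (intro conjI allI)
      assume "\<forall>\<^sub>F n in sequentially. \<forall>f\<in>set fs. \<Phi> f (E p n # xs) = Some (f p xs)"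
        "\<forall>\<^sub>F n in sequentially. \<psi> (E p n # map (\<lambda>f. f p xs) fs) = Some (g p (map (\<lambda>f. f p xs) fs))"
      then show "\<forall>\<^sub>F n in sequentially. \<theta> (E p n # xs) = Some (g p (map (\<lambda>f. f p xs) fs))"
        by eventually_elim (simp only: eq)
    qed
  qed
  ultimately show ?thesis unfolding comp_rel_def realizes_def by blast
qed

lemma cr_nth [cr_intros]: "i < m \<Longrightarrow> comp_rel E D m (\<lambda>p xs. xs ! i)"
  unfolding comp_rel_def realizes_def
  by (intro exI[of _ "\<lambda>ys. Some (ys ! Suc i)"]) (auto intro: rf_proj)

lemma cr_hd [cr_intros]: "0 < m \<Longrightarrow> comp_rel E D m (\<lambda>p xs. hd xs)"
  by (rule comp_rel_cong[OF cr_nth[of 0]]) (auto simp: hd_conv_nth)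

text \<open>Weakening under a binder: recursion, sums and bounded quantifiers push their variable
  onto the front of the argument list, and outer terms are then read through
  \<open>tl\<close>.\<close>

lemma cr_tl:
  assumes "comp_rel E D m F" shows "comp_rel E D (Suc m) (\<lambda>p xs. F p (tl xs))"
proof -
  have "comp_rel E D (Suc m) (\<lambda>p xs. F p (map (\<lambda>f. f p xs) (map (\<lambda>i p xs. xs ! Suc i) [0..<m])))"
    by (rule comp_rel_comp[OF assms]) (auto intro: cr_intros)
  then show ?thesis
  proof (rule comp_rel_cong)
    fix p and xs :: "nat list" assume "length xs = Suc m"
    then have "map (\<lambda>i. xs ! Suc i) [0..<m] = tl xs"
      using map_nth[of "tl xs"] by (cases xs) simp_all
    then show "F p (map (\<lambda>f. f p xs) (map (\<lambda>i p xs. xs ! Suc i) [0..<m])) = F p (tl xs)"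
      by (simp add: comp_def)
  qed
qed

lemmas cr_tl2 = cr_tl[THEN cr_tl]
lemmas cr_tl3 = cr_tl2[THEN cr_tl]

lemmas cr_tl_nth [cr_intros] = cr_nth[THEN cr_tl] cr_nth[THEN cr_tl2] cr_nth[THEN cr_tl3]
  cr_nth[THEN cr_tl3, THEN cr_tl]
  cr_hd[THEN cr_tl] cr_hd[THEN cr_tl2] cr_hd[THEN cr_tl3] cr_hd[THEN cr_tl3, THEN cr_tl]

lemma cr_comp1:
  assumes "comp_rel E D 1 (\<lambda>p ys. h p (ys ! 0))" "comp_rel E D m f"
  shows "comp_rel E D m (\<lambda>p xs. h p (f p xs))"
  using comp_rel_comp[OF assms(1), of "[f]" m] assms by simp

lemma cr_Suc [cr_intros]:
  assumes "comp_rel E D m f" shows "comp_rel E D m (\<lambda>p xs. Suc (f p xs))"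
proof (rule cr_comp1[OF _ assms])
  have "recfn 2 (\<lambda>ys. if (\<forall>f\<in>set [\<lambda>ys. Some (ys ! 1)]. f ys \<noteq> None)
      then (\<lambda>xs. Some (Suc (hd xs))) (map (\<lambda>f. the (f ys)) [\<lambda>ys. Some (ys ! 1)]) else None)"
    by (rule rf_comp[OF rf_succ]) (auto intro: rf_proj)
  then have "recfn 2 (\<lambda>ys. Some (Suc (ys ! 1)))" by simp
  then show "comp_rel E D 1 (\<lambda>p ys. Suc (ys ! 0))"
    unfolding comp_rel_def realizes_def
    by (intro exI[of _ "\<lambda>ys. Some (Suc (ys ! 1))"]) (auto simp: numeral_2_eq_2)
qed

lemma cr_const [cr_intros]: "comp_rel E D m (\<lambda>p xs. c)"
proof (induction c)
  case 0
  have "recfn (Suc m) (\<lambda>_. Some 0)" using rf_comp[OF rf_zero, of "[]" "Suc m"] by simp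
  then show ?case unfolding comp_rel_def realizes_def
    by (intro exI[of _ "\<lambda>ys. Some 0"]) auto
next
  case (Suc c)
  then show ?case by (rule cr_Suc)
qed

lemma cr_rec [cr_intros]:
  assumes g: "comp_rel E D m g"
    and h: "comp_rel E D (Suc (Suc m)) (\<lambda>p ys. h p (hd ys) (hd (tl ys)) (tl (tl ys)))"
    and t: "comp_rel E D m t"
  shows "comp_rel E D m (\<lambda>p xs. rec_nat (g p xs) (\<lambda>k r. h p k r xs) (t p xs))"
proof -
  obtain \<psi> where \<psi>: "realizes E D m \<psi> g" using g by (auto simp: comp_rel_def)
  obtain \<phi> where \<phi>: "realizes E D (Suc (Suc m)) \<phi> (\<lambda>p ys. h p (hd ys) (hd (tl ys)) (tl (tl ys)))"
    using h by (auto simp: comp_rel_def)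
  \<comment> \<open>\<open>prim_rec_op\<close> calls its step function on
    \<open>k # r # e # xs\<close>, whereas realizers expect the information \<open>e\<close> in
    front.\<close>
  define js where "js = [2, 0, 1] @ map (\<lambda>i. i + 3) [0..<m]"
  define \<phi>' where "\<phi>' = (\<lambda>ys. \<phi> (map (\<lambda>i. ys ! i) js))"
  have js: "map (\<lambda>i. (k # r # e # xs) ! i) js = e # k # r # xs" if "length xs = m" for k r e :: nat and xs
  proof -
    have "map (\<lambda>i. (k # r # e # xs) ! i) (map (\<lambda>i. i + 3) [0..<m]) = xs"
      using that map_nth[of xs] by (simp add: comp_def numeral_eq_Suc)
    then show ?thesis by (simp add: js_def)
  qed
  have \<phi>': "recfn (Suc (Suc (Suc m))) \<phi>'" unfolding \<phi>'_def
    by (rule recfn_reindex[of "Suc (Suc (Suc m))"]) (use \<phi> in \<open>auto simp: realizes_def js_def\<close>)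
  define R where "R = (\<lambda>ys. prim_rec_op \<psi> \<phi>' (hd ys) (tl ys))"
  have R: "recfn (Suc (Suc m)) R" unfolding R_def
    by (rule rf_prim) (use \<phi>' \<psi> in \<open>auto simp: realizes_def\<close>)
  define S where "S = (\<lambda>ys. R (map (\<lambda>i. ys ! i) ([1, 0] @ map (\<lambda>i. i + 2) [0..<m])))"
  have S: "recfn (Suc (Suc m)) S" unfolding S_def
    by (rule recfn_reindex[OF R]) auto
  have Seq: "S (e # k # xs) = prim_rec_op \<psi> \<phi>' k (e # xs)" if "length xs = m" for e k :: nat and xs
  proof -
    have "map (\<lambda>i. (e # k # xs) ! i) (map (\<lambda>i. i + 2) [0..<m]) = xs"
      using that map_nth[of xs] by (simp add: comp_def numeral_eq_Suc)
    then show ?thesis by (simp add: S_def R_def)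
  qed
  have main: "(\<forall>n. prim_rec_op \<psi> \<phi>' k (E p n # xs) \<in> {None, Some (rec_nat (g p xs) (\<lambda>k r. h p k r xs) k)}) \<and>
    (\<forall>\<^sub>F n in sequentially. prim_rec_op \<psi> \<phi>' k (E p n # xs) = Some (rec_nat (g p xs) (\<lambda>k r. h p k r xs) k))"
    if p: "p \<in> D" and xs: "length xs = m" for p xs k
  proof (induction k)
    case 0
    then show ?case using \<psi> p xs by (simp add: realizes_def)
  next
    case (Suc k)
    let ?r = "rec_nat (g p xs) (\<lambda>k r. h p k r xs) k"
    have 1: "\<phi>' (k # ?r # E p n # xs) \<in> {None, Some (h p k ?r xs)}" for n
      using \<phi>[unfolded realizes_def, THEN conjunct2, rule_format, OF p, of "k # ?r # xs"] xs
      by (simp add: \<phi>'_def js del: map_map)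
    have 2: "\<forall>\<^sub>F n in sequentially. \<phi>' (k # ?r # E p n # xs) = Some (h p k ?r xs)"
      using \<phi>[unfolded realizes_def, THEN conjunct2, rule_format, OF p, of "k # ?r # xs"] xs
      by (simp add: \<phi>'_def js del: map_map)
    have "prim_rec_op \<psi> \<phi>' (Suc k) (E p n # xs) \<in> {None, Some (h p k ?r xs)}" for n
    proof -
      have "prim_rec_op \<psi> \<phi>' k (E p n # xs) \<in> {None, Some ?r}" using Suc by blast
      then show ?thesis using 1[of n] by auto
    qed
    moreover have "\<forall>\<^sub>F n in sequentially. prim_rec_op \<psi> \<phi>' (Suc k) (E p n # xs) = Some (h p k ?r xs)"
      using 2 Suc[THEN conjunct2] by eventually_elim simp
    ultimately show ?case by simp
  qed
  have "comp_rel E D (Suc m) (\<lambda>p ys. rec_nat (g p (tl ys)) (\<lambda>k r. h p k r (tl ys)) (hd ys))"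
    unfolding comp_rel_def realizes_def
  proof (intro exI[of _ S] conjI S ballI allI impI)
    fix p ys assume p: "p \<in> D" and ys: "length (ys :: nat list) = Suc m"
    then obtain k xs where ks: "ys = k # xs" "length xs = m" by (cases ys) auto
    show "S (E p n # ys) \<in> {None, Some (rec_nat (g p (tl ys)) (\<lambda>k r. h p k r (tl ys)) (hd ys))}" for n
      using main[OF p ks(2), of k] by (simp add: ks Seq)
    show "\<forall>\<^sub>F n in sequentially. S (E p n # ys) = Some (rec_nat (g p (tl ys)) (\<lambda>k r. h p k r (tl ys)) (hd ys))"
      using main[OF p ks(2), of k] by (simp add: ks Seq)
  qed
  then have "comp_rel E D m (\<lambda>p xs. (\<lambda>p ys. rec_nat (g p (tl ys)) (\<lambda>k r. h p k r (tl ys)) (hd ys)) p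
     (map (\<lambda>f. f p xs) (t # map (\<lambda>i p xs. xs ! i) [0..<m])))"
    by (rule comp_rel_comp) (auto intro: cr_intros t)
  then show ?thesis
  proof (rule comp_rel_cong)
    fix p and xs :: "nat list" assume "length xs = m"
    then have "map ((!) xs) [0..<m] = xs" using map_nth by metis
    then show "(\<lambda>p ys. rec_nat (g p (tl ys)) (\<lambda>k r. h p k r (tl ys)) (hd ys)) p
     (map (\<lambda>f. f p xs) (t # map (\<lambda>i p xs. xs ! i) [0..<m])) = rec_nat (g p xs) (\<lambda>k r. h p k r xs) (t p xs)"
      by (simp add: comp_def)
  qed
qed

text \<open>Partial answers cannot produce a false minimum: \<open>rf_mu\<close> demands a value at
  every smaller argument, so an unsettled test blocks the search instead of being passed over. Up to
  the true minimum there are only finitely many tests, and these settle together.\<close>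

lemma cr_Least:
  assumes f: "comp_rel E D (Suc m) (\<lambda>p ys. f p (hd ys) (tl ys))"
    and ex: "\<And>p xs. p \<in> D \<Longrightarrow> length xs = m \<Longrightarrow> \<exists>y. f p y xs = 0"
  shows "comp_rel E D m (\<lambda>p xs. LEAST y. f p y xs = 0)"
proof -
  obtain \<phi> where \<phi>: "realizes E D (Suc m) \<phi> (\<lambda>p ys. f p (hd ys) (tl ys))"
    using f by (auto simp: comp_rel_def)
  define \<phi>' where "\<phi>' = (\<lambda>ys. \<phi> (map (\<lambda>i. ys ! i) ([1, 0] @ map (\<lambda>i. i + 2) [0..<m])))"
  have \<phi>'r: "recfn (Suc (Suc m)) \<phi>'" unfolding \<phi>'_def
    by (rule recfn_reindex[of "Suc (Suc m)"]) (use \<phi> in \<open>auto simp: realizes_def\<close>)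
  have \<phi>'eq: "\<phi>' (y # e # xs) = \<phi> (e # y # xs)" if "length xs = m" for e y :: nat and xs
  proof -
    have "map (\<lambda>i. (y # e # xs) ! i) (map (\<lambda>i. i + 2) [0..<m]) = xs"
      using that map_nth[of xs] by (simp add: comp_def numeral_eq_Suc)
    then show ?thesis by (simp add: \<phi>'_def)
  qed
  define P where "P = (\<lambda>ys y. \<phi>' (y # ys) = Some 0 \<and> (\<forall>z<y. \<phi>' (z # ys) \<noteq> None))"
  define \<mu> where "\<mu> = (\<lambda>ys. if (\<exists>y. P ys y) then Some (LEAST y. P ys y) else None)"
  have \<mu>: "recfn (Suc m) \<mu>" unfolding \<mu>_def P_def by (rule rf_mu[OF \<phi>'r])
  show ?thesis unfolding comp_rel_def realizes_def
  proof (intro exI[of _ \<mu>] conjI \<mu> ballI allI impI)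
    fix p and xs :: "nat list" assume p: "p \<in> D" and xs: "length xs = m"
    let ?L = "LEAST y. f p y xs = 0"
    have L0: "f p ?L xs = 0" using ex[OF p xs] by (rule LeastI_ex)
    have 1: "\<phi>' (y # E p n # xs) \<in> {None, Some (f p y xs)}" for n y
      using \<phi>[unfolded realizes_def, THEN conjunct2, rule_format, OF p, of "y # xs"] xs
      by (simp add: \<phi>'eq)
    have 2: "\<forall>\<^sub>F n in sequentially. \<phi>' (y # E p n # xs) = Some (f p y xs)" for y
      using \<phi>[unfolded realizes_def, THEN conjunct2, rule_format, OF p, of "y # xs"] xs
      by (simp add: \<phi>'eq)
    have Py: "(LEAST y. P (E p n # xs) y) = ?L" if "P (E p n # xs) y0" for y0 n
    proof -
      define y where "y = (LEAST y. P (E p n # xs) y)"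
      have "P (E p n # xs) y" unfolding y_def using that by (rule LeastI)
      then have y: "\<phi>' (y # E p n # xs) = Some 0" "\<And>z. z < y \<Longrightarrow> \<phi>' (z # E p n # xs) \<noteq> None"
        by (auto simp: P_def)
      have y0: "f p y xs = 0" using y(1) 1[where n=n and y=y] by simp
      have "f p z xs \<noteq> 0" if "z < y" for z
      proof
        assume "f p z xs = 0"
        then have "\<phi>' (z # E p n # xs) = Some 0" using y(2)[OF that] 1[where n=n and y=z] by auto
        then have "P (E p n # xs) z" using y(2) that by (simp add: P_def)
        then show False using not_less_Least that unfolding y_def by blast
      qed
      then have "?L = y" using y0 by (intro Least_equality) (use leI in blast)+
      then show ?thesis by (simp add: y_def)
    qed
    show "\<mu> (E p n # xs) \<in> {None, Some ?L}" for n
    proof (cases "\<exists>y. P (E p n # xs) y")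
      case True
      then obtain y where "P (E p n # xs) y" ..
      from Py[OF this] True show ?thesis by (simp add: \<mu>_def)
    next
      case False
      then have "\<mu> (E p n # xs) = None" unfolding \<mu>_def by (rule if_not_P)
      then show ?thesis by simp
    qed
    have "\<forall>\<^sub>F n in sequentially. \<forall>y\<in>{..?L}. \<phi>' (y # E p n # xs) = Some (f p y xs)"
      using 2 by (simp add: eventually_ball_finite)
    then show "\<forall>\<^sub>F n in sequentially. \<mu> (E p n # xs) = Some ?L"
    proof eventually_elim
      case (elim n)
      then have L: "P (E p n # xs) ?L" using L0 by (simp add: P_def)
      then have "\<exists>y. P (E p n # xs) y" ..
      then show ?case using Py[OF L] by (simp add: \<mu>_def)
    qed
  qed
qed

subsection \<open>Arithmetic\<close>

lemma cr_add [cr_intros]: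
  assumes "comp_rel E D m f" "comp_rel E D m g"
  shows "comp_rel E D m (\<lambda>p xs. f p xs + g p xs)"
proof -
  have eq: "a + b = rec_nat a (\<lambda>k r. Suc r) b" for a b :: nat by (induction b) auto
  show ?thesis unfolding eq by (intro cr_intros assms; simp)
qed

lemma cr_pred:
  assumes "comp_rel E D m f"
  shows "comp_rel E D m (\<lambda>p xs. f p xs - 1)"
proof -
  have eq: "a - 1 = rec_nat 0 (\<lambda>k r. k) a" for a :: nat by (cases a) auto
  show ?thesis unfolding eq by (intro cr_intros assms; simp)
qed

lemma cr_mult [cr_intros]:
  assumes "comp_rel E D m f" "comp_rel E D m g"
  shows "comp_rel E D m (\<lambda>p xs. f p xs * g p xs)"
proof -
  have eq: "a * b = rec_nat 0 (\<lambda>k r. r + a) b" for a b :: nat by (induction b) auto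
  show ?thesis unfolding eq by (intro cr_intros assms assms[THEN cr_tl2]; simp)
qed

lemma cr_diff [cr_intros]:
  assumes "comp_rel E D m f" "comp_rel E D m g"
  shows "comp_rel E D m (\<lambda>p xs. f p xs - g p xs)"
proof -
  have eq: "a - b = rec_nat a (\<lambda>k r. r - 1) b" for a b :: nat by (induction b) auto
  have "comp_rel E D m (\<lambda>p xs. rec_nat (f p xs) (\<lambda>k r. r - 1) (g p xs))"
    by (intro cr_intros cr_pred assms; simp)
  then show ?thesis unfolding eq[symmetric] .
qed

lemma cr_power [cr_intros]:
  assumes "comp_rel E D m f" "comp_rel E D m g"
  shows "comp_rel E D m (\<lambda>p xs. f p xs ^ g p xs)"
proof -
  have eq: "a ^ b = rec_nat 1 (\<lambda>k r. r * a) b" for a b :: nat by (induction b) auto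
  show ?thesis unfolding eq by (intro cr_intros assms assms[THEN cr_tl2]; simp)
qed

text \<open>Removes the accumulator from view: recursion passes \<open>k # r # xs\<close>, but a
  summand depends on \<open>k\<close> and \<open>xs\<close> only.\<close>

lemma cr_skip:
  assumes "comp_rel E D (Suc m) (\<lambda>p ys. f p (hd ys) (tl ys))"
  shows "comp_rel E D (Suc (Suc m)) (\<lambda>p ys. f p (hd ys) (tl (tl ys)))"
proof -
  have "comp_rel E D (Suc (Suc m)) (\<lambda>p xs. (\<lambda>p ys. f p (hd ys) (tl ys)) p
     (map (\<lambda>f. f p xs) ((\<lambda>p xs. hd xs) # map (\<lambda>i p xs. xs ! Suc (Suc i)) [0..<m])))"
    by (rule comp_rel_comp[OF assms(1)]) (auto intro!: cr_intros)
  then show ?thesis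
  proof (rule comp_rel_cong)
    fix p and xs :: "nat list" assume "length xs = Suc (Suc m)"
    then have "map (\<lambda>i. xs ! Suc (Suc i)) [0..<m] = tl (tl xs)"
      using map_nth[of "tl (tl xs)"] by (cases xs; cases "tl xs") simp_all
    then show "(\<lambda>p ys. f p (hd ys) (tl ys)) p
     (map (\<lambda>f. f p xs) ((\<lambda>p xs. hd xs) # map (\<lambda>i p xs. xs ! Suc (Suc i)) [0..<m])) = f p (hd xs) (tl (tl xs))"
      by (simp add: comp_def)
  qed
qed

lemma cr_sum [cr_intros]:
  assumes "comp_rel E D (Suc m) (\<lambda>p ys. f p (hd ys) (tl ys))" "comp_rel E D m t"
  shows "comp_rel E D m (\<lambda>p xs. \<Sum>i<t p xs. f p i xs)"
proof -
  have eq: "(\<Sum>i<b. F i) = rec_nat 0 (\<lambda>k r. r + F k) b" for F :: "nat \<Rightarrow> nat" and b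
    by (induction b) auto
  show ?thesis unfolding eq by (intro cr_intros assms cr_skip; simp)
qed

lemma cr_le [cr_intros]:
  assumes "comp_rel E D m f" "comp_rel E D m g"
  shows "comp_rel E D m (\<lambda>p xs. of_bool (f p xs \<le> g p xs))"
proof -
  have eq: "of_bool (a \<le> b) = 1 - (a - b)" for a b :: nat by auto
  show ?thesis unfolding eq by (intro cr_intros assms; simp)
qed

lemma cr_less [cr_intros]:
  assumes "comp_rel E D m f" "comp_rel E D m g"
  shows "comp_rel E D m (\<lambda>p xs. of_bool (f p xs < g p xs))"
proof -
  have eq: "of_bool (a < b) = 1 - (Suc a - b)" for a b :: nat by auto
  show ?thesis unfolding eq by (intro cr_intros assms; simp)
qed

lemma cr_eq [cr_intros]:
  assumes "comp_rel E D m f" "comp_rel E D m g"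
  shows "comp_rel E D m (\<lambda>p xs. of_bool (f p xs = g p xs))"
proof -
  have eq: "of_bool (a = b) = 1 - ((a - b) + (b - a))" for a b :: nat by auto
  show ?thesis unfolding eq by (intro cr_intros assms; simp)
qed

lemma cr_not [cr_intros]:
  assumes "comp_rel E D m (\<lambda>p xs. of_bool (P p xs))"
  shows "comp_rel E D m (\<lambda>p xs. of_bool (\<not> P p xs))"
proof -
  have eq: "of_bool (\<not> a) = 1 - (of_bool a :: nat)" for a by auto
  show ?thesis unfolding eq by (intro cr_intros assms; simp)
qed

lemma cr_conj [cr_intros]:
  assumes "comp_rel E D m (\<lambda>p xs. of_bool (P p xs))" "comp_rel E D m (\<lambda>p xs. of_bool (Q p xs))"
  shows "comp_rel E D m (\<lambda>p xs. of_bool (P p xs \<and> Q p xs))"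
  unfolding of_bool_conj by (intro cr_intros assms)

lemma cr_imp [cr_intros]:
  assumes "comp_rel E D m (\<lambda>p xs. of_bool (P p xs))" "comp_rel E D m (\<lambda>p xs. of_bool (Q p xs))"
  shows "comp_rel E D m (\<lambda>p xs. of_bool (P p xs \<longrightarrow> Q p xs))"
proof -
  have eq: "(a \<longrightarrow> b) = (\<not> (a \<and> \<not> b))" for a b by auto
  show ?thesis unfolding eq by (intro cr_intros assms)
qed

lemma cr_if [cr_intros]:
  assumes "comp_rel E D m (\<lambda>p xs. of_bool (P p xs))" "comp_rel E D m f" "comp_rel E D m g"
  shows "comp_rel E D m (\<lambda>p xs. if P p xs then f p xs else g p xs)"
proof -
  have eq: "(if a then b else c) = of_bool a * b + of_bool (\<not> a) * c" for a and b c :: nat by auto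
  show ?thesis unfolding eq by (intro cr_intros assms)
qed

lemma cr_all [cr_intros]:
  assumes "comp_rel E D (Suc m) (\<lambda>p ys. of_bool (P p (hd ys) (tl ys)))" "comp_rel E D m t"
  shows "comp_rel E D m (\<lambda>p xs. of_bool (\<forall>i<t p xs. P p i xs))"
proof -
  have eq: "of_bool (\<forall>i<b. F i) = (of_bool ((\<Sum>i<b. of_bool (\<not> F i)) = (0::nat)) :: nat)" for F and b :: nat by auto
  show ?thesis unfolding eq by (intro cr_intros assms)
qed

lemma cr_ex [cr_intros]:
  assumes "comp_rel E D (Suc m) (\<lambda>p ys. of_bool (P p (hd ys) (tl ys)))" "comp_rel E D m t"
  shows "comp_rel E D m (\<lambda>p xs. of_bool (\<exists>i<t p xs. P p i xs))"
proof -
  have eq: "(\<exists>i<b. F i) = (\<not> (\<forall>i<b. \<not> F i))" for F and b :: nat by auto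
  show ?thesis unfolding eq by (intro cr_intros assms)
qed

text \<open>Division counts the positive multiples of \<open>b\<close> up to \<open>a\<close>, which
  turns it into a bounded sum; the conjunct \<open>0 < b\<close> matches the convention
  \<open>a div 0 = 0\<close>.\<close>

lemma card_Suc_mult_le: "(\<Sum>i<a. of_bool (Suc i * b \<le> a \<and> 0 < b)) = a div (b::nat)"
proof (cases "b = 0")
  case False
  have "{i. i < a \<and> Suc i * b \<le> a} = {..<a div b}"
  proof (intro set_eqI iffI; clarsimp)
    fix i assume "b + i * b \<le> a"
    then have "Suc i \<le> a div b" using False by (simp add: less_eq_div_iff_mult_less_eq)
    then show "i < a div b" by simp
  next
    fix i assume i: "i < a div b"
    then have "Suc i * b \<le> a" using False by (simp only: Suc_le_eq flip: less_eq_div_iff_mult_less_eq)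
    moreover have "i < a" using i div_le_dividend[of a b] by linarith
    ultimately show "i < a \<and> b + i * b \<le> a" by simp
  qed
  then show ?thesis using False by (simp add: of_bool_def sum.If_cases Collect_conj_eq lessThan_def)
qed auto

lemma cr_div [cr_intros]:
  assumes "comp_rel E D m f" "comp_rel E D m g"
  shows "comp_rel E D m (\<lambda>p xs. f p xs div g p xs)"
  unfolding card_Suc_mult_le[symmetric]
  by (intro cr_intros assms assms[THEN cr_tl]; simp)

lemma cr_mod [cr_intros]:
  assumes "comp_rel E D m f" "comp_rel E D m g"
  shows "comp_rel E D m (\<lambda>p xs. f p xs mod g p xs)"
  unfolding modulo_nat_def by (intro cr_intros assms)

lemma cr_even [cr_intros]:
  assumes "comp_rel E D m f"
  shows "comp_rel E D m (\<lambda>p xs. of_bool (even (f p xs)))"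
  unfolding even_iff_mod_2_eq_zero by (intro cr_intros assms)

lemma cr_prod_encode [cr_intros]:
  assumes "comp_rel E D m f" "comp_rel E D m g"
  shows "comp_rel E D m (\<lambda>p xs. prod_encode (f p xs, g p xs))"
  unfolding prod_encode_def triangle_def prod.case by (intro cr_intros assms)

text \<open>Inverts the pairing by bounded search: both components are at most the code, and the
  indicator leaves a single summand.\<close>

lemma prod_decode_sum:
  fixes h :: "nat \<Rightarrow> nat \<Rightarrow> nat"
  shows "(\<Sum>a<Suc c. \<Sum>b<Suc c. of_bool (prod_encode (a, b) = c) * h a b) = h (fst (prod_decode c)) (snd (prod_decode c))"
proof -
  obtain x y where xy: "prod_decode c = (x, y)" by fastforce
  then have c: "c = prod_encode (x, y)" by (metis prod_decode_inverse)
  have xc: "x < Suc c" "y < Suc c" using le_prod_encode_1 le_prod_encode_2 by (auto simp: c less_Suc_eq_le)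
  have "(\<Sum>a<Suc c. \<Sum>b<Suc c. of_bool (prod_encode (a, b) = c) * h a b)
    = (\<Sum>a<Suc c. \<Sum>b<Suc c. if b = y then (if a = x then h a b else 0) else 0)"
    unfolding c by (intro sum.cong refl) (auto simp: prod_encode_eq)
  also have "\<dots> = h x y" using xc by (simp add: sum.delta del: sum.lessThan_Suc)
  finally show ?thesis by (simp add: xy)
qed

lemma cr_fst [cr_intros]:
  assumes "comp_rel E D m f"
  shows "comp_rel E D m (\<lambda>p xs. fst (prod_decode (f p xs)))"
  unfolding prod_decode_sum[of _ "\<lambda>a b. a", symmetric]
  by (intro cr_intros assms assms[THEN cr_tl] assms[THEN cr_tl2]; simp)

lemma cr_snd [cr_intros]:
  assumes "comp_rel E D m f"
  shows "comp_rel E D m (\<lambda>p xs. snd (prod_decode (f p xs)))"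
  unfolding prod_decode_sum[of _ "\<lambda>a b. b", symmetric]
  by (intro cr_intros assms assms[THEN cr_tl] assms[THEN cr_tl2]; simp)

lemma cr_isqrt [cr_intros]:
  assumes "comp_rel E D m f"
  shows "comp_rel E D m (\<lambda>p xs. floor_sqrt (f p xs))"
proof -
  have eq: "floor_sqrt a = (\<Sum>i<a. of_bool (Suc i * Suc i \<le> a))" for a
  proof -
    have "{i. i < a \<and> Suc i * Suc i \<le> a} = {..<floor_sqrt a}"
    proof (intro set_eqI iffI; unfold mem_Collect_eq lessThan_iff)
      fix i assume "i < a \<and> Suc i * Suc i \<le> a"
      then show "i < floor_sqrt a" using le_floor_sqrt_iff[of "Suc i" a] by (simp add: power2_eq_square Suc_le_eq)
    next
      fix i assume i: "i < floor_sqrt a"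
      then have "Suc i * Suc i \<le> a" using le_floor_sqrt_iff[of "Suc i" a] by (simp add: power2_eq_square Suc_le_eq)
      then show "i < a \<and> Suc i * Suc i \<le> a" by simp
    qed
    then show ?thesis by (simp add: of_bool_def sum.If_cases Collect_conj_eq lessThan_def)
  qed
  show ?thesis unfolding eq by (intro cr_intros assms assms[THEN cr_tl]; simp)
qed

subsection \<open>Lists and the oracle\<close>

text \<open>Past the end of a list, truncated subtraction and \<open>prod_decode 0 = (0, 0)\<close> make \<open>lnth\<close> return 0,
  which is a code of the rational number 0, the default entry in \<open>ratvec_of_code\<close>.\<close>

definition lrest :: "nat \<Rightarrow> nat" where "lrest c = snd (prod_decode (c - 1))"

definition ldrop :: "nat \<Rightarrow> nat \<Rightarrow> nat" where "ldrop c i = rec_nat c (\<lambda>k r. lrest r) i"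

definition lnth :: "nat \<Rightarrow> nat \<Rightarrow> nat" where "lnth c i = fst (prod_decode (ldrop c i - 1))"

definition llen :: "nat \<Rightarrow> nat" where "llen c = (\<Sum>i<c. of_bool (ldrop c i \<noteq> 0))"

lemma cr_ldrop [cr_intros]:
  assumes "comp_rel E D m f" "comp_rel E D m g"
  shows "comp_rel E D m (\<lambda>p xs. ldrop (f p xs) (g p xs))"
  unfolding ldrop_def lrest_def by (intro cr_intros assms; simp)

lemma cr_lnth [cr_intros]:
  assumes "comp_rel E D m f" "comp_rel E D m g"
  shows "comp_rel E D m (\<lambda>p xs. lnth (f p xs) (g p xs))"
  unfolding lnth_def by (intro cr_intros assms)

lemma cr_llen [cr_intros]:
  assumes "comp_rel E D m f"
  shows "comp_rel E D m (\<lambda>p xs. llen (f p xs))"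
  unfolding llen_def by (intro cr_intros assms assms[THEN cr_tl]; simp)

lemma prod_decode_0: "prod_decode 0 = (0, 0)"
  by (metis add_0 le_prod_encode_1 le_prod_encode_2 le_zero_eq prod_decode_inverse surj_pair)

lemma ldrop_encode: "ldrop (list_encode ys) i = list_encode (drop i ys)"
proof (induction i)
  case (Suc i)
  have "lrest (list_encode zs) = list_encode (drop 1 zs)" for zs
    by (cases zs) (auto simp: lrest_def prod_decode_0)
  then show ?case using Suc by (simp add: ldrop_def drop_drop)
qed (simp add: ldrop_def)

lemma lnth_encode: "lnth (list_encode ys) i = (if i < length ys then ys ! i else 0)"
proof (cases "i < length ys")
  case True
  then have "drop i ys = ys ! i # drop (Suc i) ys" by (rule Cons_nth_drop_Suc[symmetric])
  then show ?thesis using True by (simp add: lnth_def ldrop_encode)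
qed (simp add: lnth_def ldrop_encode prod_decode_0)

lemma length_le_list_encode: "length ys \<le> list_encode ys"
proof (induction ys)
  case (Cons y ys)
  then show ?case using le_prod_encode_2[of "list_encode ys" y] by simp
qed simp

lemma llen_encode: "llen (list_encode ys) = length ys"
proof -
  have "list_encode zs = 0 \<longleftrightarrow> zs = []" for zs by (cases zs) auto
  then have "llen (list_encode ys) = (\<Sum>i<list_encode ys. of_bool (i < length ys))"
    by (simp add: llen_def ldrop_encode not_le)
  also have "{i. i < list_encode ys \<and> i < length ys} = {..<length ys}"
    using length_le_list_encode[of ys] by auto
  then have "(\<Sum>i<list_encode ys. of_bool (i < length ys)) = length ys"
    by (simp add: of_bool_def sum.If_cases Collect_conj_eq lessThan_def)
  finally show ?thesis .
qed

lemma llen_decode: "llen c = length (list_decode c)"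
  using llen_encode[of "list_decode c"] by simp

lemma lnth_decode: "lnth c i = (if i < length (list_decode c) then list_decode c ! i else 0)"
  using lnth_encode[of "list_decode c" i] by simp

lemma cr_list_encode:
  assumes "\<And>j. j \<in> set js \<Longrightarrow> comp_rel E D m (f j)"
  shows "comp_rel E D m (\<lambda>p xs. list_encode (map (\<lambda>j. f j p xs) js))"
  using assms by (induction js) (auto intro!: cr_intros)

text \<open>Taking the constant sequences as contexts turns the class into that of total
  recursive functions whose first argument is the context itself.\<close>

lemma cr_context: "comp_rel (\<lambda>c n. c) UNIV m (\<lambda>c xs. c)"
  unfolding comp_rel_def realizes_def
  by (intro exI[of _ "\<lambda>ys. Some (ys ! 0)"]) (auto intro: rf_proj)

text \<open>A query must stay unanswered while the prefix is too short, since \<open>lnth\<close>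
  would then return 0, possibly a wrong value.\<close>

lemma cr_oracle [cr_intros]:
  assumes "comp_rel prefix_code D m f"
  shows "comp_rel prefix_code D m (\<lambda>p xs. p (f p xs))"
proof (rule cr_comp1[OF _ assms])
  have "comp_rel (\<lambda>c n. c) UNIV 1 (\<lambda>c xs. lnth c (xs ! 0))"
    by (intro cr_intros cr_context; simp)
  then obtain \<psi> where \<psi>: "recfn 2 \<psi>" "\<And>c i. \<psi> [c, i] = Some (lnth c i)"
    unfolding comp_rel_def realizes_def by (auto simp: eval_nat_numeral length_Suc_conv)
  have "comp_rel (\<lambda>c n. c) UNIV 2 (\<lambda>c xs. of_bool (llen c \<le> xs ! 1))"
    by (intro cr_intros cr_context; simp)
  then obtain \<phi> where \<phi>: "recfn 3 \<phi>" "\<And>c y i. \<phi> [c, y, i] = Some (of_bool (llen c \<le> i))"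
    unfolding comp_rel_def realizes_def by (auto simp: eval_nat_numeral length_Suc_conv)
  define \<phi>' where "\<phi>' = (\<lambda>ys. \<phi> (map (\<lambda>i. ys ! i) [1, 0, 2]))"
  have "recfn (Suc 2) \<phi>'" unfolding \<phi>'_def by (rule recfn_reindex[OF \<phi>(1)]) auto
  note \<mu> = rf_mu[OF this]
  \<comment> \<open>The test ignores the search variable \<open>y\<close>: the search stops at once
    if \<open>i < llen c\<close> and diverges otherwise, so \<open>\<mu>\<close> serves as a
    guard.\<close>
  define \<mu> where "\<mu> = (\<lambda>xs. if (\<exists>y. \<phi>' (y # xs) = Some 0 \<and> (\<forall>z<y. \<phi>' (z # xs) \<noteq> None))
                   then Some (LEAST y. \<phi>' (y # xs) = Some 0 \<and> (\<forall>z<y. \<phi>' (z # xs) \<noteq> None))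
                   else None)"
  have \<phi>'eq: "\<phi>' [y, c, i] = Some (of_bool (llen c \<le> i))" for y c i
    by (simp add: \<phi>'_def \<phi>)
  have \<mu>eq: "\<mu> [c, i] \<noteq> None \<longleftrightarrow> i < llen c" for c i
    by (auto simp: \<mu>_def \<phi>'eq)
  define \<theta> where "\<theta> = (\<lambda>xs. if (\<forall>f\<in>set [\<psi>, \<mu>]. f xs \<noteq> None)
    then (\<lambda>xs. Some (xs ! 0)) (map (\<lambda>f. the (f xs)) [\<psi>, \<mu>]) else None)"
  have "recfn 2 \<theta>" unfolding \<theta>_def
    by (rule rf_comp[where m=2]) (use \<psi> \<mu> in \<open>auto intro: rf_proj simp: \<mu>_def\<close>)
  moreover have "\<theta> [prefix_code p n, i] = (if i < n then Some (p i) else None)" for p n i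
    using \<mu>eq[of "prefix_code p n" i]
    by (auto simp: \<theta>_def \<psi> prefix_code_def llen_encode lnth_encode)
  ultimately show "comp_rel prefix_code D 1 (\<lambda>p ys. p (ys ! 0))"
    unfolding comp_rel_def realizes_def
    by (intro exI[of _ \<theta>]) (auto simp: eval_nat_numeral length_Suc_conv
      intro: eventually_mono[OF eventually_gt_at_top])
qed

lemma computable_partial_comp_rel:
  assumes "comp_rel prefix_code D 1 (\<lambda>p xs. \<Phi> p (xs ! 0))"
  shows "computable_partial (\<lambda>p. if p \<in> D then Some (\<Phi> p) else None)"
proof -
  obtain \<psi> where \<psi>: "realizes prefix_code D 1 \<psi> (\<lambda>p xs. \<Phi> p (xs ! 0))"
    using assms by (auto simp: comp_rel_def)
  show ?thesis unfolding computable_partial_def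
  proof (intro exI[of _ \<psi>] conjI allI impI)
    show "recfn 2 \<psi>" using \<psi> by (simp add: realizes_def eval_nat_numeral)
    fix p q i assume "(if p \<in> D then Some (\<Phi> p) else None) = Some q"
    then have p: "p \<in> D" "q = \<Phi> p" by (auto split: if_splits)
    have 1: "\<psi> [prefix_code p n, i] \<in> {None, Some (\<Phi> p i)}"
      and 2: "\<forall>\<^sub>F n in sequentially. \<psi> [prefix_code p n, i] = Some (\<Phi> p i)" for n
      using \<psi>[unfolded realizes_def, THEN conjunct2, rule_format, OF p(1), of "[i]"] by auto
    show "\<exists>n. \<psi> [prefix_code p n, i] \<noteq> None"
      using eventually_happens[OF 2] by auto
    show "v = q i" if "\<psi> [prefix_code p n, i] = Some v" for n v
      using 1[of n] that p(2) by auto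
  qed
qed

subsection \<open>Rational approximation\<close>

abbreviation rval :: "nat \<Rightarrow> real" where "rval c \<equiv> real_of_rat (rat_of_code c)"

text \<open>As \<open>nat\<close> cuts off negative values, \<open>trunc l t\<close> and
  \<open>trunc l (- t)\<close> are the integer parts of \<open>2 ^ l\<close> times the positive and
  the negative part of \<open>t\<close>; a signed number becomes a pair of naturals.\<close>

definition trunc :: "nat \<Rightarrow> real \<Rightarrow> nat" where "trunc l t = nat \<lfloor>2 ^ l * t\<rfloor>"

lemma trunc_diff: "\<bar>real (trunc l t) - real (trunc l (- t)) - 2 ^ l * t\<bar> \<le> 1"
  unfolding trunc_def by simp linarith

lemma trunc_sum: "real (trunc l t + trunc l (- t)) \<le> 2 ^ l * \<bar>t\<bar>" "2 ^ l * \<bar>t\<bar> \<le> real (trunc l t + trunc l (- t)) + 1"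
proof -
  have "2 ^ l * \<bar>t\<bar> = \<bar>2 ^ l * t\<bar>" by (simp add: abs_mult)
  then show "real (trunc l t + trunc l (- t)) \<le> 2 ^ l * \<bar>t\<bar>" "2 ^ l * \<bar>t\<bar> \<le> real (trunc l t + trunc l (- t)) + 1"
    unfolding trunc_def by simp_all linarith+
qed

lemma trunc_zero: "trunc l t = 0 \<or> trunc l (- t) = 0"
  unfolding trunc_def by simp linarith

text \<open>The positive and the negative part of \<open>int_decode s\<close>: even codes stand for
  nonnegative integers, odd codes for negative ones.\<close>

definition pnum :: "nat \<Rightarrow> nat" where "pnum s = (if even s then s div 2 else 0)"
definition nnum :: "nat \<Rightarrow> nat" where "nnum s = (if even s then 0 else Suc (s div 2))"

definition tpos :: "nat \<Rightarrow> nat \<Rightarrow> nat" where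
  "tpos l c = (2 ^ l * pnum (fst (prod_decode c))) div Suc (snd (prod_decode c))"
definition tneg :: "nat \<Rightarrow> nat \<Rightarrow> nat" where
  "tneg l c = (2 ^ l * nnum (fst (prod_decode c))) div Suc (snd (prod_decode c))"

lemma int_decode_pnum_nnum: "int_decode s = int (pnum s) - int (nnum s)"
  by (simp add: int_decode_def sum_decode_def pnum_def nnum_def)

lemma rval_eq:
  "rval c = (real (pnum (fst (prod_decode c))) - real (nnum (fst (prod_decode c)))) / real (Suc (snd (prod_decode c)))"
  unfolding rat_of_code_def
  by (cases "prod_decode c") (simp add: int_decode_pnum_nnum of_rat_divide of_rat_diff of_rat_add)

lemma trunc_rval: "trunc l (rval c) = tpos l c" "trunc l (- rval c) = tneg l c"
proof -
  obtain s b where sb: "prod_decode c = (s, b)" by fastforce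
  have fl: "nat \<lfloor>2 ^ l * (real k / real (Suc b))\<rfloor> = (2 ^ l * k) div Suc b" for k
    using floor_divide_of_nat_eq[where 'a=real, of "2 ^ l * k" "Suc b"] by simp
  have z: "nat \<lfloor>2 ^ l * - (real k / real (Suc b))\<rfloor> = 0" for k
  proof -
    have "2 ^ l * (real k / real (Suc b)) \<ge> 0" by simp
    then show ?thesis by (simp only: mult_minus_right) linarith
  qed
  have "trunc l (rval c) = tpos l c \<and> trunc l (- rval c) = tneg l c"
  proof (cases "even s")
    case True
    then have n: "nnum s = 0" by (simp add: nnum_def)
    then have "rval c = real (pnum s) / real (Suc b)" by (simp add: rval_eq sb)
    then show ?thesis by (simp only: trunc_def fl z tpos_def tneg_def sb n fst_conv snd_conv) simp
  next
    case False
    then have n: "pnum s = 0" by (simp add: pnum_def)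
    then have "rval c = - (real (nnum s) / real (Suc b))" by (simp add: rval_eq sb)
    then show ?thesis by (simp only: trunc_def fl z tpos_def tneg_def sb n fst_conv snd_conv minus_minus) simp
  qed
  then show "trunc l (rval c) = tpos l c" "trunc l (- rval c) = tneg l c" by auto
qed

text \<open>At most one of the two truncations is nonzero. The integer \<open>a \<ge> 0\<close> has
  code \<open>2 * a\<close> and \<open>- b < 0\<close> has code \<open>2 * b - 1\<close>, which
  truncated subtraction turns into 0 for \<open>b = 0\<close>; denominators are stored minus one.
  The fraction is not reduced, so that a bound on \<open>t\<close> bounds the code.\<close>

definition tcode :: "nat \<Rightarrow> real \<Rightarrow> nat" where
  "tcode l t = prod_encode (2 * trunc l t + (2 * trunc l (- t) - 1), 2 ^ l - 1)"

lemma rval_tcode: "rval (tcode l t) = (real (trunc l t) - real (trunc l (- t))) / 2 ^ l"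
proof -
  have l: "real (2 ^ l - Suc 0) = 2 ^ l - 1" by (simp add: of_nat_diff)
  consider "trunc l (- t) = 0" | "trunc l t = 0" "trunc l (- t) \<noteq> 0" using trunc_zero[of l t] by auto
  then show ?thesis
  proof cases
    case 1
    then show ?thesis by (simp add: rval_eq tcode_def pnum_def nnum_def l)
  next
    case 2
    then obtain k where "trunc l (- t) = Suc k" by (cases "trunc l (- t)") auto
    then show ?thesis using 2 by (simp add: rval_eq tcode_def pnum_def nnum_def l)
  qed
qed

lemma rval_tcode_dist: "\<bar>rval (tcode l t) - t\<bar> \<le> 1 / 2 ^ l"
proof -
  have "rval (tcode l t) - t = (real (trunc l t) - real (trunc l (- t)) - 2 ^ l * t) / 2 ^ l"
    by (simp add: rval_tcode diff_divide_distrib)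
  then have "\<bar>rval (tcode l t) - t\<bar> = \<bar>real (trunc l t) - real (trunc l (- t)) - 2 ^ l * t\<bar> / 2 ^ l"
    by (simp add: abs_divide)
  then show ?thesis using trunc_diff[of l t] by (simp add: divide_right_mono)
qed

lemma length_enum: "length (Enum.enum :: 'n::enum list) = CARD('n)"
  by (simp add: card_UNIV_length_enum)

lemma ratvec_nth:
  assumes "j < CARD('n)"
  shows "(ratvec_of_code c :: real ^ 'n::enum) $ (Enum.enum ! j) = rval (lnth c j)"
proof -
  let ?e = "Enum.enum :: 'n list" and ?c = "list_decode c"
  have j: "j < length ?e" using assms by (simp add: length_enum)
  have d: "distinct ?e" by (rule enum_distinct)
  have 0: "rval 0 = 0" by (simp add: rval_eq prod_decode_0 pnum_def nnum_def)
  show ?thesis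
  proof (cases "j < length ?c")
    case True
    have "map_of (zip ?e ?c) (?e ! j) = Some (?c ! j)"
      by (rule map_of_is_SomeI) (use True j d in \<open>auto simp: set_zip distinct_conv_nth map_fst_zip_take\<close>)
    then show ?thesis using True by (simp add: ratvec_of_code_def lnth_decode)
  next
    case False
    have "map_of (zip ?e ?c) (?e ! j) = None"
      unfolding map_of_eq_None_iff using False j d by (auto simp: set_zip nth_eq_iff_index_eq)
    then show ?thesis using False 0 by (simp add: ratvec_of_code_def lnth_decode)
  qed
qed

lemma sum_enum: "(\<Sum>i\<in>(UNIV :: 'n::enum set). g i) = (\<Sum>j<CARD('n). g (Enum.enum ! j))"
proof -
  have "bij_betw ((!) (Enum.enum :: 'n list)) {..<CARD('n)} UNIV"
    by (rule bij_betw_nth) (auto simp: enum_distinct length_enum enum_UNIV)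
  then show ?thesis by (rule sum.reindex_bij_betw[symmetric])
qed

lemma dist_enum:
  "dist (a :: real ^ 'n::enum) b = L2_set (\<lambda>j. \<bar>a $ (Enum.enum ! j) - b $ (Enum.enum ! j)\<bar>) {..<CARD('n)}"
  by (simp add: dist_vec_def L2_set_def sum_enum dist_real_def)

definition absdiff :: "nat \<Rightarrow> nat \<Rightarrow> nat" where "absdiff a b = (a - b) + (b - a)"

text \<open>Rounding the coordinates first keeps the computation within the natural numbers, at
  the price of an error that depends on the dimension only.\<close>

definition idist :: "nat \<Rightarrow> nat \<Rightarrow> nat \<Rightarrow> nat \<Rightarrow> nat" where
  "idist n l a b = floor_sqrt (\<Sum>j<n.
     absdiff (tpos l (lnth a j) + tneg l (lnth b j)) (tpos l (lnth b j) + tneg l (lnth a j)) ^ 2)"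

text \<open>Rounding both points changes each scaled coordinate difference by at most 2, hence the
  norm by at most twice the dimension; the integer square root costs 1 more.\<close>

lemma idist_bound:
  "\<bar>real (idist (CARD('n)) l a b) - 2 ^ l * dist (ratvec_of_code a :: real ^ 'n::enum) (ratvec_of_code b)\<bar>
    \<le> 2 * real (CARD('n)) + 1"
proof -
  let ?n = "CARD('n)"
  define e where "e j = absdiff (tpos l (lnth a j) + tneg l (lnth b j)) (tpos l (lnth b j) + tneg l (lnth a j))" for j
  define v where "v j = 2 ^ l * \<bar>rval (lnth a j) - rval (lnth b j)\<bar>" for j
  have ev: "\<bar>real (e j) - v j\<bar> \<le> 2" for j
  proof -
    have "real (e j) = \<bar>(real (tpos l (lnth a j)) - real (tneg l (lnth a j))) - (real (tpos l (lnth b j)) - real (tneg l (lnth b j)))\<bar>"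
      unfolding e_def absdiff_def by linarith
    moreover have "v j = \<bar>2 ^ l * rval (lnth a j) - 2 ^ l * rval (lnth b j)\<bar>"
      unfolding v_def by (simp add: abs_mult flip: right_diff_distrib)
    ultimately show ?thesis
      using trunc_diff[of l "rval (lnth a j)"] trunc_diff[of l "rval (lnth b j)"]
      unfolding trunc_rval by linarith
  qed
  have c2: "L2_set (\<lambda>j. 2) {..<?n} \<le> 2 * real ?n" using L2_set_le_sum[of "{..<?n}" "\<lambda>j. 2"] by simp
  have 1: "L2_set (\<lambda>j. real (e j)) {..<?n} \<le> L2_set v {..<?n} + 2 * real ?n"
  proof -
    have "L2_set (\<lambda>j. real (e j)) {..<?n} \<le> L2_set (\<lambda>j. v j + 2) {..<?n}"
      by (rule L2_set_mono) (use ev in \<open>auto simp: abs_le_iff diff_le_eq add.commute\<close>)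
    also have "\<dots> \<le> L2_set v {..<?n} + L2_set (\<lambda>j. 2) {..<?n}" by (rule L2_set_triangle_ineq)
    finally show ?thesis using c2 by linarith
  qed
  have 2: "L2_set v {..<?n} \<le> L2_set (\<lambda>j. real (e j)) {..<?n} + 2 * real ?n"
  proof -
    have "L2_set v {..<?n} \<le> L2_set (\<lambda>j. real (e j) + 2) {..<?n}"
    proof (rule L2_set_mono)
      show "v j \<le> real (e j) + 2" for j using ev[of j] by linarith
      show "0 \<le> v j" for j by (simp add: v_def)
    qed
    also have "\<dots> \<le> L2_set (\<lambda>j. real (e j)) {..<?n} + L2_set (\<lambda>j. 2) {..<?n}" by (rule L2_set_triangle_ineq)
    finally show ?thesis using c2 by linarith
  qed
  have 3: "L2_set v {..<?n} = 2 ^ l * dist (ratvec_of_code a :: real ^ 'n::enum) (ratvec_of_code b)"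
    unfolding dist_enum v_def L2_set_right_distrib[OF zero_le_power[OF zero_le_numeral]]
    by (rule L2_set_cong) (auto simp: ratvec_nth)
  define S where "S = (\<Sum>j<?n. e j ^ 2)"
  have S: "L2_set (\<lambda>j. real (e j)) {..<?n} = sqrt (real S)" by (simp add: L2_set_def S_def)
  have "real (floor_sqrt S) \<le> sqrt (real S)"
    using floor_sqrt_power2_le[of S] by (intro real_le_rsqrt) (simp flip: of_nat_power)
  moreover have "sqrt (real S) \<le> real (floor_sqrt S) + 1"
  proof (rule real_le_lsqrt)
    have "real S \<le> real ((Suc (floor_sqrt S))\<^sup>2)" using Suc_floor_sqrt_power2_gt[of S] by (intro of_nat_mono) simp
    then show "real S \<le> (real (floor_sqrt S) + 1)\<^sup>2" by (simp add: add.commute)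
  qed auto
  moreover have "idist ?n l a b = floor_sqrt S" by (simp add: idist_def S_def e_def)
  ultimately show ?thesis using 1 2 3 S by linarith
qed

definition iabs :: "nat \<Rightarrow> nat \<Rightarrow> nat" where "iabs l b = tpos l b + tneg l b"

lemma iabs_bound: "real (iabs l b) \<le> 2 ^ l * \<bar>rval b\<bar>" "2 ^ l * \<bar>rval b\<bar> \<le> real (iabs l b) + 1"
  using trunc_sum[of l "rval b"] by (simp_all add: iabs_def trunc_rval)

definition vcode :: "nat \<Rightarrow> real ^ 'n::enum \<Rightarrow> nat" where
  "vcode l y = list_encode (map (\<lambda>j. tcode l (y $ (Enum.enum ! j))) [0..<CARD('n)])"

lemma vcode_dist: "dist (ratvec_of_code (vcode l y)) (y :: real ^ 'n::enum) \<le> real (CARD('n)) / 2 ^ l"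
proof -
  have "dist (ratvec_of_code (vcode l y)) y
    = L2_set (\<lambda>j. \<bar>rval (tcode l (y $ (Enum.enum ! j))) - y $ (Enum.enum ! j)\<bar>) {..<CARD('n)}"
    unfolding dist_enum by (rule L2_set_cong) (auto simp: ratvec_nth vcode_def lnth_encode)
  also have "\<dots> \<le> (\<Sum>j<CARD('n). \<bar>rval (tcode l (y $ (Enum.enum ! j))) - y $ (Enum.enum ! j)\<bar>)"
    by (rule L2_set_le_sum) auto
  also have "\<dots> \<le> (\<Sum>j<CARD('n). 1 / 2 ^ l)" by (rule sum_mono) (rule rval_tcode_dist)
  finally show ?thesis by simp
qed

text \<open>As \<open>n \<le> 2 ^ n\<close>, as many additional binary digits as there are
  dimensions absorb the factor \<open>n\<close> lost when coordinate errors are added.\<close>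

lemma vcode_dist_add: "dist (ratvec_of_code (vcode (l + CARD('n)) y)) (y :: real ^ 'n::enum) \<le> 1 / 2 ^ l"
proof -
  have "real (CARD('n)) \<le> 2 ^ CARD('n)" using of_nat_less_two_power[of "CARD('n)", where 'a=real] by simp
  then have "real (CARD('n)) / 2 ^ (l + CARD('n)) \<le> 1 / 2 ^ l" by (simp add: power_add field_simps)
  then show ?thesis using vcode_dist[of "l + CARD('n)" y] by linarith
qed

definition vbound :: "nat \<Rightarrow> nat \<Rightarrow> nat \<Rightarrow> nat" where
  "vbound n l M = list_encode (map (\<lambda>j. prod_encode (2 * (2 ^ l * M), 2 ^ l - 1)) [0..<n])"

lemma prod_encode_mono: "a \<le> a' \<Longrightarrow> b \<le> b' \<Longrightarrow> prod_encode (a, b) \<le> prod_encode (a', b')"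
  unfolding prod_encode_def triangle_def prod.case by (intro add_mono div_le_mono mult_le_mono) auto

lemma list_encode_mono: "list_all2 (\<le>) xs ys \<Longrightarrow> list_encode xs \<le> list_encode ys"
  by (induction rule: list_all2_induct) (auto intro: prod_encode_mono)

text \<open>Pairing and list coding are monotone, so bounded vectors have bounded codes at each
  precision. This makes the search through a net finite and limits the blocks of ones.\<close>

lemma vcode_le:
  assumes "\<And>i. \<bar>(y :: real ^ 'n::enum) $ i\<bar> \<le> real M"
  shows "vcode l y \<le> vbound (CARD('n)) l M"
proof -
  have "tcode l t \<le> prod_encode (2 * (2 ^ l * M), 2 ^ l - 1)" if "\<bar>t\<bar> \<le> real M" for t
  proof -
    have "real (trunc l t + trunc l (- t)) \<le> 2 ^ l * real M"
      using trunc_sum(1)[of l t] that by (meson mult_left_mono order_trans zero_le_numeral zero_le_power)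
    then have "real (trunc l t + trunc l (- t)) \<le> real (2 ^ l * M)" by simp
    then have "trunc l t + trunc l (- t) \<le> 2 ^ l * M" by (simp only: of_nat_le_iff)
    then show ?thesis unfolding tcode_def by (intro prod_encode_mono) auto
  qed
  then show ?thesis unfolding vcode_def vbound_def
    by (intro list_encode_mono) (auto simp: list_all2_conv_all_nth assms)
qed

definition vround :: "nat \<Rightarrow> nat \<Rightarrow> nat \<Rightarrow> nat" where
  "vround n l c = list_encode (map (\<lambda>j. prod_encode
     (2 * tpos l (lnth c j) + (2 * tneg l (lnth c j) - 1), 2 ^ l - 1)) [0..<n])"

lemma vround_eq: "vround (CARD('n)) l c = vcode l (ratvec_of_code c :: real ^ 'n::enum)"
  unfolding vround_def vcode_def by (auto simp: tcode_def ratvec_nth trunc_rval intro!: arg_cong[where f=list_encode])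

lemma cr_pnum [cr_intros]: "comp_rel E D m f \<Longrightarrow> comp_rel E D m (\<lambda>p xs. pnum (f p xs))"
  unfolding pnum_def by (intro cr_intros)

lemma cr_nnum [cr_intros]: "comp_rel E D m f \<Longrightarrow> comp_rel E D m (\<lambda>p xs. nnum (f p xs))"
  unfolding nnum_def by (intro cr_intros)

lemma cr_tpos [cr_intros]:
  "comp_rel E D m f \<Longrightarrow> comp_rel E D m g \<Longrightarrow> comp_rel E D m (\<lambda>p xs. tpos (f p xs) (g p xs))"
  unfolding tpos_def by (intro cr_intros)

lemma cr_tneg [cr_intros]:
  "comp_rel E D m f \<Longrightarrow> comp_rel E D m g \<Longrightarrow> comp_rel E D m (\<lambda>p xs. tneg (f p xs) (g p xs))"
  unfolding tneg_def by (intro cr_intros)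

lemma cr_iabs [cr_intros]:
  "comp_rel E D m f \<Longrightarrow> comp_rel E D m g \<Longrightarrow> comp_rel E D m (\<lambda>p xs. iabs (f p xs) (g p xs))"
  unfolding iabs_def by (intro cr_intros)

lemma cr_idist [cr_intros]:
  assumes "comp_rel E D m l" "comp_rel E D m f" "comp_rel E D m g"
  shows "comp_rel E D m (\<lambda>p xs. idist n (l p xs) (f p xs) (g p xs))"
  unfolding idist_def absdiff_def by (intro cr_intros assms[THEN cr_tl]; simp)

lemma cr_vbound [cr_intros]:
  "comp_rel E D m l \<Longrightarrow> comp_rel E D m f \<Longrightarrow> comp_rel E D m (\<lambda>p xs. vbound n (l p xs) (f p xs))"
  unfolding vbound_def by (intro cr_intros cr_list_encode)

lemma cr_vround [cr_intros]:
  "comp_rel E D m l \<Longrightarrow> comp_rel E D m f \<Longrightarrow> comp_rel E D m (\<lambda>p xs. vround n (l p xs) (f p xs))"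
  unfolding vround_def by (intro cr_list_encode cr_intros)

subsection \<open>Unary coding\<close>

definition zpos :: "(nat \<Rightarrow> nat) \<Rightarrow> nat \<Rightarrow> nat" where "zpos u m = m + (\<Sum>i<m. u i)"

text \<open>The binary sequence \<open>1\<^bsup>u 0\<^esup> 0 1\<^bsup>u 1\<^esup> 0 \<dots>\<close>; its \<open>m\<close>-th block starts at \<open>zpos u m\<close>.\<close>

definition uenc :: "(nat \<Rightarrow> nat) \<Rightarrow> nat \<Rightarrow> nat" where
  "uenc u i = of_bool (\<not> (\<exists>m<Suc i. zpos u (Suc m) = Suc i))"

text \<open>The counterpart of \<open>zpos\<close> for an arbitrary sequence: the position after the
  \<open>m\<close>-th zero. The doubly negated test has the shape \<open>f y = 0\<close> that
  \<open>cr_Least\<close> searches for.\<close>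

definition zstart :: "(nat \<Rightarrow> nat) \<Rightarrow> nat \<Rightarrow> nat" where
  "zstart \<beta> = rec_nat 0 (\<lambda>k r. Suc (LEAST i. of_bool (\<not> (r \<le> i \<and> \<beta> i = 0)) = (0::nat)))"

definition udec :: "(nat \<Rightarrow> nat) \<Rightarrow> nat \<Rightarrow> nat" where
  "udec \<beta> m = zstart \<beta> (Suc m) - zstart \<beta> m - 1"

lemma zpos_Suc: "zpos u (Suc m) = Suc (zpos u m + u m)"
  by (simp add: zpos_def)

lemma zpos_ge: "m \<le> zpos u m"
  by (simp add: zpos_def)

lemma zpos_strict_mono: "strict_mono (zpos u)"
  by (simp add: strict_mono_Suc_iff zpos_Suc)

lemma uenc_le_1: "uenc u i \<le> 1"
  by (simp add: uenc_def)

text \<open>The bounded search in \<open>uenc\<close> reaches this \<open>m\<close> because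
  \<open>m \<le> zpos u m\<close>.\<close>

lemma uenc_end: "uenc u (zpos u m + u m) = 0"
  using zpos_ge[of m u] by (auto simp: uenc_def zpos_Suc intro!: exI[of _ m])

lemma uenc_block:
  assumes "zpos u m \<le> i" "i < zpos u m + u m"
  shows "uenc u i = 1"
proof -
  have "zpos u (Suc k) \<noteq> Suc i" for k
  proof
    assume k: "zpos u (Suc k) = Suc i"
    have "zpos u m < zpos u (Suc k)" "zpos u (Suc k) < zpos u (Suc m)"
      using assms k by (auto simp: zpos_Suc[of u m])
    then have "m < Suc k" "Suc k < Suc m" using zpos_strict_mono by (auto simp: strict_mono_less)
    then show False by simp
  qed
  then show ?thesis by (simp add: uenc_def)
qed

lemma zstart_0 [simp]: "zstart \<beta> 0 = 0"
  by (simp add: zstart_def)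

lemma zstart_Suc: "zstart \<beta> (Suc m) = Suc (LEAST i. zstart \<beta> m \<le> i \<and> \<beta> i = 0)"
  by (simp add: zstart_def)

lemma zstart_eq_zpos:
  assumes "\<And>i. i < zpos u M \<Longrightarrow> \<beta> i = uenc u i" "j \<le> M"
  shows "zstart \<beta> j = zpos u j"
  using assms(2)
proof (induction j)
  case (Suc j)
  have le: "zpos u (Suc j) \<le> zpos u M" using Suc.prems zpos_strict_mono by (simp add: strict_mono_less_eq)
  have "(LEAST i. zpos u j \<le> i \<and> \<beta> i = 0) = zpos u j + u j"
  proof (rule Least_equality)
    show "zpos u j \<le> zpos u j + u j \<and> \<beta> (zpos u j + u j) = 0"
      using assms(1) le by (simp add: zpos_Suc uenc_end)
    fix i assume i: "zpos u j \<le> i \<and> \<beta> i = 0"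
    show "zpos u j + u j \<le> i"
    proof (rule ccontr)
      assume "\<not> zpos u j + u j \<le> i"
      then have "uenc u i = 1" "\<beta> i = uenc u i" using i le assms(1) by (auto simp: zpos_Suc uenc_block)
      then show False using i by simp
    qed
  qed
  then show ?case using Suc by (simp add: zstart_Suc zpos_Suc)
qed (simp add: zpos_def)

text \<open>Decoding is continuous, with an explicit modulus. This matters for cluster points, whose
  bits agree with different codings on different prefixes.\<close>

lemma udec_eq:
  assumes "\<And>i. i < zpos u (Suc m) \<Longrightarrow> \<beta> i = uenc u i" "j \<le> m"
  shows "udec \<beta> j = u j"
proof -
  have "zstart \<beta> j = zpos u j" "zstart \<beta> (Suc j) = zpos u (Suc j)"
    using assms(2) by (auto intro!: zstart_eq_zpos[OF assms(1)])
  then show ?thesis by (simp add: udec_def zpos_Suc)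
qed

lemma uenc_infinite: "\<exists>\<^sub>\<infinity>i. uenc u i = 0"
  unfolding INFM_nat_le
proof
  fix m
  show "\<exists>n\<ge>m. uenc u n = 0" using zpos_ge[of m u] uenc_end[of u m] by (intro exI[of _ "zpos u m + u m"]) auto
qed

lemma udec_uenc: "udec (uenc u) = u"
  using udec_eq[of u _ "uenc u"] by fastforce

section \<open>Block lengths in finite words\<close>

definition zcount :: "(nat \<Rightarrow> nat) \<Rightarrow> nat \<Rightarrow> nat" where
  "zcount \<beta> L = (\<Sum>i<L. of_bool (\<beta> i = 0))"

text \<open>Position \<open>i\<close> lies in the block numbered \<open>zcount \<beta> i\<close>, so
  this is the number of ones of block \<open>m\<close> seen so far, also while the block is still
  open.\<close>

definition blen :: "(nat \<Rightarrow> nat) \<Rightarrow> nat \<Rightarrow> nat \<Rightarrow> nat" where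
  "blen \<beta> L m = (\<Sum>i<L. of_bool (\<beta> i \<noteq> 0 \<and> zcount \<beta> i = m))"

lemma zcount_mono: "L \<le> L' \<Longrightarrow> zcount \<beta> L \<le> zcount \<beta> L'"
  unfolding zcount_def by (rule sum_mono2) auto

lemma blen_mono: "L \<le> L' \<Longrightarrow> blen \<beta> L m \<le> blen \<beta> L' m"
  unfolding blen_def by (rule sum_mono2) auto

lemma blen_card: "blen \<beta> L m = card {i. i < L \<and> \<beta> i \<noteq> 0 \<and> zcount \<beta> i = m}"
  by (simp add: blen_def of_bool_def sum.If_cases Collect_conj_eq lessThan_def)

context
  fixes \<beta> :: "nat \<Rightarrow> nat"
  assumes inf: "\<exists>\<^sub>\<infinity>i. \<beta> i = 0"
begin

lemma zstart_step:
  "zstart \<beta> m < zstart \<beta> (Suc m)" "\<beta> (zstart \<beta> (Suc m) - 1) = 0"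
  "zstart \<beta> m \<le> i \<Longrightarrow> i < zstart \<beta> (Suc m) - 1 \<Longrightarrow> \<beta> i \<noteq> 0"
proof -
  let ?L = "LEAST i. zstart \<beta> m \<le> i \<and> \<beta> i = 0"
  have "\<exists>i. zstart \<beta> m \<le> i \<and> \<beta> i = 0" using inf unfolding INFM_nat_le by blast
  then have L: "zstart \<beta> m \<le> ?L \<and> \<beta> ?L = 0" by (rule LeastI_ex)
  then show "zstart \<beta> m < zstart \<beta> (Suc m)" "\<beta> (zstart \<beta> (Suc m) - 1) = 0"
    by (simp_all add: zstart_Suc)
  show "\<beta> i \<noteq> 0" if "zstart \<beta> m \<le> i" "i < zstart \<beta> (Suc m) - 1"
    using not_less_Least[of i "\<lambda>i. zstart \<beta> m \<le> i \<and> \<beta> i = 0"] that by (simp add: zstart_Suc)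
qed

lemma zcount_block:
  assumes "zcount \<beta> (zstart \<beta> m) = m" "zstart \<beta> m \<le> i" "i < zstart \<beta> (Suc m)"
  shows "zcount \<beta> i = m"
  using assms(2,3)
proof (induction i rule: dec_induct)
  case (step i)
  then show ?case using zstart_step(3)[of m i] by (simp add: zcount_def)
qed (simp add: assms(1))

lemma zcount_zstart: "zcount \<beta> (zstart \<beta> m) = m"
proof (induction m)
  case (Suc m)
  obtain k where k: "zstart \<beta> (Suc m) = Suc k" "zstart \<beta> m \<le> k"
    using zstart_step(1)[of m] by (cases "zstart \<beta> (Suc m)") auto
  then have "zcount \<beta> k = m" using zcount_block[OF Suc] by simp
  moreover have "\<beta> k = 0" using zstart_step(2)[of m] k by simp
  ultimately show ?case by (simp add: k zcount_def)
qed (simp add: zcount_def)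

text \<open>Two ways to say that block \<open>m\<close> is complete within \<open>L\<close> bits:
  the tree counts zeros, decoding looks at the start of the next block.\<close>

lemma zcount_less_iff: "m < zcount \<beta> L \<longleftrightarrow> zstart \<beta> (Suc m) \<le> L"
proof
  assume "zstart \<beta> (Suc m) \<le> L"
  then show "m < zcount \<beta> L" using zcount_mono[of "zstart \<beta> (Suc m)" L \<beta>] zcount_zstart[of "Suc m"] by simp
next
  assume m: "m < zcount \<beta> L"
  show "zstart \<beta> (Suc m) \<le> L"
  proof (rule ccontr)
    assume "\<not> zstart \<beta> (Suc m) \<le> L"
    then have "zcount \<beta> L \<le> zcount \<beta> (zstart \<beta> (Suc m) - 1)" by (intro zcount_mono) simp
    also have "\<dots> = m" using zstart_step(1)[of m] by (intro zcount_block[OF zcount_zstart]) auto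
    finally show False using m by simp
  qed
qed

lemma blen_eq_udec:
  assumes "m < zcount \<beta> L"
  shows "blen \<beta> L m = udec \<beta> m"
proof -
  have "{i. i < L \<and> \<beta> i \<noteq> 0 \<and> zcount \<beta> i = m} = {zstart \<beta> m..<zstart \<beta> (Suc m) - 1}"
  proof (intro set_eqI iffI)
    fix i assume i: "i \<in> {i. i < L \<and> \<beta> i \<noteq> 0 \<and> zcount \<beta> i = m}"
    then have 1: "i < zstart \<beta> (Suc m)" using zcount_less_iff[of m i] by auto
    have "\<beta> i \<noteq> 0" using i by simp
    then have "i \<noteq> zstart \<beta> (Suc m) - 1" using zstart_step(2)[of m] by metis
    moreover have "zstart \<beta> m \<le> i"
    proof (cases m)
      case (Suc k)
      then show ?thesis using i zcount_less_iff[of k i] by auto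
    qed simp
    ultimately show "i \<in> {zstart \<beta> m..<zstart \<beta> (Suc m) - 1}" using 1 by simp
  next
    fix i assume i: "i \<in> {zstart \<beta> m..<zstart \<beta> (Suc m) - 1}"
    then have "\<beta> i \<noteq> 0" using zstart_step(3)[of m i] by simp
    moreover have "zcount \<beta> i = m" using i by (intro zcount_block[OF zcount_zstart]) auto
    ultimately show "i \<in> {i. i < L \<and> \<beta> i \<noteq> 0 \<and> zcount \<beta> i = m}"
      using i assms zcount_less_iff[of m L] by auto
  qed
  then show ?thesis by (simp add: blen_card udec_def)
qed

lemma blen_le_udec: "blen \<beta> L m \<le> udec \<beta> m"
proof -
  let ?L = "max L (zstart \<beta> (Suc m))"
  have "blen \<beta> L m \<le> blen \<beta> ?L m" by (rule blen_mono) simp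
  also have "\<dots> = udec \<beta> m" by (rule blen_eq_udec) (simp add: zcount_less_iff)
  finally show ?thesis .
qed

end

text \<open>After a last zero the open block would grow past every bound. The hypothesis therefore
  has to include \<open>m = zcount \<beta> L\<close>, the block not yet completed.\<close>

lemma infinite_zeros:
  assumes "\<And>L m. m \<le> zcount \<beta> L \<Longrightarrow> blen \<beta> L m \<le> B m"
  shows "\<exists>\<^sub>\<infinity>i. \<beta> i = (0::nat)"
proof (rule ccontr)
  assume "\<not> ?thesis"
  then obtain k where k: "\<And>i. k \<le> i \<Longrightarrow> \<beta> i \<noteq> 0" by (auto simp: INFM_nat_le)
  have zc: "zcount \<beta> (k + d) = zcount \<beta> k" for d
    by (induction d) (simp_all add: zcount_def k)
  let ?m = "zcount \<beta> k"
  let ?L = "k + Suc (B ?m)"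
  have "{k..<?L} \<subseteq> {i. i < ?L \<and> \<beta> i \<noteq> 0 \<and> zcount \<beta> i = ?m}"
    using k zc by (auto simp: le_iff_add)
  then have "card {k..<?L} \<le> blen \<beta> ?L ?m" unfolding blen_card by (intro card_mono) auto
  moreover have "blen \<beta> ?L ?m \<le> B ?m" by (rule assms) (simp add: zc del: add_Suc_right)
  ultimately show False by simp
qed

lemma cr_udec:
  assumes "comp_rel E D 1 (\<lambda>p xs. \<beta> p (xs ! 0))" "\<And>p. p \<in> D \<Longrightarrow> \<exists>\<^sub>\<infinity>i. \<beta> p i = 0"
  shows "comp_rel E D 1 (\<lambda>p xs. udec (\<beta> p) (xs ! 0))"
proof -
  note b = cr_comp1[OF assms(1)]
  have "\<exists>i. of_bool (\<not> (r \<le> i \<and> \<beta> p i = 0)) = (0::nat)" if "p \<in> D" for p r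
    using assms(2)[OF that] unfolding INFM_nat_le by auto
  then show ?thesis unfolding udec_def zstart_def
    by (intro cr_intros cr_Least b; simp)
qed

subsection \<open>Cauchy names\<close>

lemma cauchy_rep_SomeI:
  assumes "\<And>i j. i \<le> j \<Longrightarrow> dist (\<alpha> (p i)) (\<alpha> (p j)) \<le> (1/2) ^ i" "(\<lambda>i. \<alpha> (p i)) \<longlonglongrightarrow> x"
  shows "cauchy_rep \<alpha> p = Some x"
  using assms by (auto simp: cauchy_rep_def limI)

lemma cauchy_rep_limit:
  fixes \<alpha> :: "nat \<Rightarrow> 'a::complete_space"
  assumes "\<And>i j. i \<le> j \<Longrightarrow> dist (\<alpha> (p i)) (\<alpha> (p j)) \<le> (1/2) ^ i"
  obtains x where "(\<lambda>i. \<alpha> (p i)) \<longlonglongrightarrow> x" "cauchy_rep \<alpha> p = Some x"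
proof -
  have "Cauchy (\<lambda>i. \<alpha> (p i))"
  proof (rule CauchyI')
    fix e :: real assume "0 < e"
    then obtain M where M: "(1/2) ^ M < e" using real_arch_pow_inv[of e "1/2"] by auto
    show "\<exists>M. \<forall>m\<ge>M. \<forall>n>m. dist (\<alpha> (p m)) (\<alpha> (p n)) < e"
    proof (intro exI[of _ M] allI impI)
      fix m n assume "M \<le> m" "m < n"
      then have "dist (\<alpha> (p m)) (\<alpha> (p n)) \<le> (1/2) ^ m" using assms by simp
      also have "\<dots> \<le> (1/2) ^ M" using \<open>M \<le> m\<close> by (simp add: power_decreasing)
      finally show "dist (\<alpha> (p m)) (\<alpha> (p n)) < e" using M by simp
    qed
  qed
  then obtain x where "(\<lambda>i. \<alpha> (p i)) \<longlonglongrightarrow> x" by (auto simp: Cauchy_convergent_iff convergent_def)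
  then show ?thesis using that cauchy_rep_SomeI[of \<alpha> p, OF assms] by blast
qed

lemma cauchy_rep_SomeD:
  fixes \<alpha> :: "nat \<Rightarrow> 'a::complete_space"
  assumes "cauchy_rep \<alpha> p = Some x"
  shows "(\<lambda>i. \<alpha> (p i)) \<longlonglongrightarrow> x" "dist (\<alpha> (p i)) x \<le> (1/2) ^ i"
proof -
  have c: "dist (\<alpha> (p i)) (\<alpha> (p j)) \<le> (1/2) ^ i" if "i \<le> j" for i j
    using assms that by (auto simp: cauchy_rep_def split: if_splits)
  obtain x' where "(\<lambda>i. \<alpha> (p i)) \<longlonglongrightarrow> x'" "cauchy_rep \<alpha> p = Some x'" using cauchy_rep_limit[of \<alpha> p] c by blast
  then show l: "(\<lambda>i. \<alpha> (p i)) \<longlonglongrightarrow> x" using assms by simp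
  show "dist (\<alpha> (p i)) x \<le> (1/2) ^ i"
    by (rule LIMSEQ_le_const2[OF tendsto_dist[OF tendsto_const l]]) (use c in auto)
qed

text \<open>The shift by 2 makes two entries differ by at most \<open>(1/2) ^ (i + 1)\<close>, half
  of what a Cauchy name allows; the other half is room for the inexact test
  \<open>close\<close>.\<close>

definition vname :: "real ^ 'n::enum \<Rightarrow> nat \<Rightarrow> nat" where
  "vname y m = vcode (m + 2 + CARD('n)) y"

lemma vname_dist: "dist (ratvec_of_code (vname y m)) (y :: real ^ 'n::enum) \<le> (1/2) ^ (m + 2)"
  using vcode_dist_add[of "m + 2" y] by (simp add: vname_def power_one_over)

lemma vname_cauchy:
  fixes y :: "real ^ 'n::enum"
  assumes "i \<le> j"
  shows "dist (ratvec_of_code (vname y i)) (ratvec_of_code (vname y j) :: real ^ 'n::enum) \<le> (1/2) ^ (i + 1)"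
proof -
  have "dist (ratvec_of_code (vname y i)) (ratvec_of_code (vname y j) :: real ^ 'n::enum)
    \<le> (1/2) ^ (i + 2) + (1/2) ^ (j + 2)"
    by (rule order_trans[OF dist_triangle2 add_mono[OF vname_dist vname_dist]])
  also have "(1/2 :: real) ^ (j + 2) \<le> (1/2) ^ (i + 2)" using assms by (intro power_decreasing) auto
  finally show ?thesis by simp
qed

subsection \<open>Reductions to the Bolzano--Weierstrass theorem\<close>

primrec bitsum :: "(nat \<Rightarrow> nat) \<Rightarrow> nat \<Rightarrow> nat" where
  "bitsum b 0 = 0"
| "bitsum b (Suc k) = 4 * bitsum b k + b k"

text \<open>This is \<open>\<lfloor>4 ^ (i + 1) q + 1/3\<rfloor> mod 4\<close>, where \<open>q\<close> is the rational
  number coded by \<open>c\<close>.\<close>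

definition bitdec :: "nat \<Rightarrow> nat \<Rightarrow> nat" where
  "bitdec c i = ((Suc (snd (prod_decode c)) + 3 * 4 ^ Suc i * pnum (fst (prod_decode c)))
      - 3 * 4 ^ Suc i * nnum (fst (prod_decode c))) div (3 * Suc (snd (prod_decode c))) mod 4"

text \<open>Digits 0 and 1 in base 4: \<open>d\<close> further digits contribute at most
  \<open>1 + 4 + ... + 4 ^ (d - 1) = (4 ^ d - 1) / 3\<close>, written without division.\<close>

lemma bitsum_add:
  assumes "\<And>i. b i \<le> 1"
  shows "bitsum b j * 4 ^ d \<le> bitsum b (j + d) \<and> 3 * bitsum b (j + d) + 1 \<le> 3 * (bitsum b j * 4 ^ d) + 4 ^ d"
proof (induction d)
  case (Suc d)
  then show ?case using assms[of "j + d"] by simp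
qed simp

text \<open>Let \<open>N\<close> be the number formed by the first \<open>i + 1\<close> digits.
  After scaling by \<open>4 ^ (i + 1)\<close> the exact number lies in \<open>[N, N + 1/3]\<close>,
  as all digits are at most 1, and the error is at most 1/4. Adding 1/3 moves the approximation into
  \<open>[N + 1/12, N + 11/12]\<close>, where the integer part is \<open>N\<close>, whose last digit
  is \<open>b i\<close>.\<close>

lemma bitdec_eq:
  assumes b: "\<And>i. b i \<le> 1" and i: "i < k"
    and d: "\<bar>rval c - real (bitsum b k) / 4 ^ k\<bar> \<le> 1 / 4 ^ (i + 2)"
  shows "bitdec c i = b i"
proof -
  define N where "N = bitsum b (Suc i)"
  define s where "s = fst (prod_decode c)"
  define w where "w = Suc (snd (prod_decode c))"
  define F where "F = (4::nat) ^ Suc i"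
  have w: "w > 0" by (simp add: w_def)
  obtain e where k: "k = Suc i + e" using i by (metis less_iff_Suc_add add_Suc)
  define t where "t = real (bitsum b k) / 4 ^ k"
  have s4: "real F * t = real (bitsum b k) / 4 ^ e"
    by (simp add: F_def t_def k power_add)
  have "N * 4 ^ e \<le> bitsum b k \<and> 3 * bitsum b k + 1 \<le> 3 * (N * 4 ^ e) + 4 ^ e"
    using bitsum_add[of b "Suc i" e, OF b] by (simp only: k N_def)
  then have "real (N * 4 ^ e) \<le> real (bitsum b k) \<and> real (3 * bitsum b k + 1) \<le> real (3 * (N * 4 ^ e) + 4 ^ e)"
    by (simp only: of_nat_le_iff)
  then have N: "real N \<le> real F * t" "real F * t \<le> real N + 1/3"
    unfolding s4 by (simp_all add: field_simps)
  have "real F * \<bar>rval c - t\<bar> \<le> real F * (1 / 4 ^ (i + 2))"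
    using d unfolding t_def by (intro mult_left_mono) auto
  also have "\<dots> = 1/4" by (simp add: F_def)
  finally have "\<bar>real F * rval c - real F * t\<bar> \<le> 1/4"
    by (simp add: abs_mult flip: right_diff_distrib)
  then have r: "real N + 1/12 \<le> real F * rval c + 1/3" "real F * rval c + 1/3 \<le> real N + 11/12"
    using N unfolding abs_le_iff by linarith+
  have rc: "(real F * rval c + 1/3) * (3 * real w) = real (w + 3 * F * pnum s) - real (3 * F * nnum s)"
    using w by (simp add: rval_eq s_def[symmetric] w_def[symmetric] field_simps)
  have "(real N + 1/12) * (3 * real w) \<le> (real F * rval c + 1/3) * (3 * real w)"
    "(real F * rval c + 1/3) * (3 * real w) \<le> (real N + 11/12) * (3 * real w)"
    using r by (intro mult_right_mono; simp)+
  then have X: "real N * (3 * real w) \<le> real (w + 3 * F * pnum s) - real (3 * F * nnum s)"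
    "real (w + 3 * F * pnum s) - real (3 * F * nnum s) < (real N + 1) * (3 * real w)"
    unfolding rc using w by (simp_all add: field_simps)
  \<comment> \<open>As \<open>N\<close> is nonnegative, the natural subtraction in
    \<open>bitdec\<close> does not truncate, even if the rational coded by \<open>c\<close> is
    slightly negative.\<close>
  have "0 \<le> real N * (3 * real w)" by simp
  then have le: "3 * F * nnum s \<le> w + 3 * F * pnum s" using X(1) by linarith
  define x where "x = (w + 3 * F * pnum s) - 3 * F * nnum s"
  have rx: "real x = real (w + 3 * F * pnum s) - real (3 * F * nnum s)"
    unfolding x_def using le by (rule of_nat_diff)
  have "real (N * (3 * w)) \<le> real x" "real x < real (Suc N * (3 * w))"
    using X unfolding rx by (simp_all add: algebra_simps)
  then have "N * (3 * w) \<le> x" "x < Suc N * (3 * w)" by (simp_all only: of_nat_le_iff of_nat_less_iff)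
  then have "x div (3 * w) = N" by (intro div_nat_eqI) (simp_all add: mult.commute)
  then have "bitdec c i = N mod 4" by (simp only: bitdec_def x_def F_def s_def w_def)
  also have "\<dots> = b i mod 4" by (simp add: N_def)
  also have "\<dots> = b i" using b[of i] by simp
  finally show ?thesis .
qed

lemma bitsum_less: "(\<And>i. b i \<le> 1) \<Longrightarrow> bitsum b k < 4 ^ k"
  using bitsum_add[of b 0 k] by simp

lemma cr_bitsum:
  assumes "comp_rel E D (Suc m) (\<lambda>p ys. b p (hd ys) (tl ys))" "comp_rel E D m t"
  shows "comp_rel E D m (\<lambda>p xs. bitsum (\<lambda>i. b p i xs) (t p xs))"
proof -
  have eq: "bitsum b k = (\<Sum>i<k. b i * 4 ^ (k - Suc i))" for b k
  proof (induction k)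
    case (Suc k)
    have "(\<Sum>i<k. b i * 4 ^ (Suc k - Suc i)) = (\<Sum>i<k. 4 * (b i * 4 ^ (k - Suc i)))"
      by (rule sum.cong) (auto simp: Suc_diff_Suc simp flip: power_Suc)
    then show ?case using Suc by (simp add: sum_distrib_left)
  qed simp
  show ?thesis unfolding eq by (intro cr_intros assms assms(2)[THEN cr_tl]; simp)
qed

lemma cr_bitdec [cr_intros]:
  "comp_rel E D m f \<Longrightarrow> comp_rel E D m g \<Longrightarrow> comp_rel E D m (\<lambda>p xs. bitdec (f p xs) (g p xs))"
  unfolding bitdec_def by (intro cr_intros)

lemma rho_R_const: "rho_R (\<lambda>_. c) = Some (rval c)"
  unfolding rho_R_def by (rule cauchy_rep_SomeI) auto

lemma diagonal_subseq:
  assumes "\<And>m. \<exists>\<^sub>\<infinity>k. P m k"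
  obtains \<phi> :: "nat \<Rightarrow> nat" where "strict_mono \<phi>" "\<And>m. P m (\<phi> m)"
proof -
  have "\<exists>\<phi>. \<forall>m. P m (\<phi> m) \<and> \<phi> m < \<phi> (Suc m)"
  proof (rule dependent_nat_choice)
    show "\<exists>k. P 0 k" using assms[of 0] by (auto simp: INFM_nat)
    show "\<exists>k'. P (Suc m) k' \<and> k < k'" for k m using assms[of "Suc m"] by (auto simp: INFM_nat)
  qed
  then show ?thesis using that by (auto simp: strict_mono_Suc_iff)
qed

text \<open>The decoded sequence \<open>u\<close> need not be the name of any \<open>Y p k\<close>.
  But each initial segment of \<open>u\<close> agrees with that of the name of \<open>Y p k\<close>
  for infinitely many \<open>k\<close>: this makes \<open>u\<close> a Cauchy name, and a diagonal
  choice of such \<open>k\<close> gives a subsequence of \<open>Y p\<close> with the same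
  limit.\<close>

lemma BWT_reduction:
  fixes Y :: "baire \<Rightarrow> nat \<Rightarrow> nat" and f :: "'x \<Rightarrow> (real ^ 'n::enum) set"
  assumes Y: "comp_rel prefix_code UNIV 1 (\<lambda>p xs. Y p (xs ! 0))"
    and bdd: "\<And>p x. \<delta> p = Some x \<Longrightarrow> x \<in> S \<Longrightarrow> bounded (range (\<lambda>k. ratvec_of_code (Y p k) :: real ^ 'n::enum))"
    and sol: "\<And>p x \<phi> y. \<delta> p = Some x \<Longrightarrow> x \<in> S \<Longrightarrow> strict_mono \<phi> \<Longrightarrow>
        (\<lambda>k. ratvec_of_code (Y p (\<phi> k))) \<longlonglongrightarrow> y \<Longrightarrow> y \<in> f x"
  shows "strong_weihrauch_le \<delta> rho_Rn S f (seq_rep rho_R) rho_R BWT_dom BWT_val"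
proof -
  let ?n = "CARD('n)"
  define U where "U p k m = vround ?n (m + 2 + ?n) (Y p k)" for p k m
  have U_eq: "U p k = vname (ratvec_of_code (Y p k) :: real ^ 'n::enum)" for p k
    by (rule ext) (simp add: U_def vname_def vround_eq)
  \<comment> \<open>Stage \<open>k\<close> uses \<open>k\<close> bits only, so the real is rational
    and a constant sequence names it. The numerator is doubled because even codes stand for
    nonnegative integers.\<close>
  define code where "code p k = prod_encode (2 * bitsum (uenc (U p k)) k, 4 ^ k - 1)" for p k
  define K where "K p c = code p (fst (prod_decode c))" for p c
  \<comment> \<open>\<open>(1/2) ^ (2 * i + 5)\<close> is half of the error
    \<open>1 / 4 ^ (i + 2)\<close> that \<open>bitdec_eq\<close> tolerates; the other half is for
    the distance between the cluster point and \<open>s k\<close>.\<close>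
  define B where "B q i = bitdec (q (2 * i + 5)) i" for q :: baire and i
  define Z where "Z = {q. \<exists>\<^sub>\<infinity>i. B q i = 0}"
  have "comp_rel prefix_code UNIV 1 (\<lambda>p xs. K p (xs ! 0))"
    unfolding K_def code_def uenc_def zpos_def U_def
    by (intro cr_intros cr_bitsum cr_comp1[OF Y]; simp)
  then have Kc: "computable_partial (\<lambda>p. Some (K p))"
    using computable_partial_comp_rel[of UNIV K] by simp
  have "comp_rel prefix_code Z 1 (\<lambda>q xs. B q (xs ! 0))"
    unfolding B_def by (intro cr_intros; simp)
  then have "comp_rel prefix_code Z 1 (\<lambda>q xs. udec (B q) (xs ! 0))"
    by (rule cr_udec) (simp add: Z_def)
  then have Hc: "computable_partial (\<lambda>q. if q \<in> Z then Some (udec (B q)) else None)"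
    by (rule computable_partial_comp_rel)
  show ?thesis unfolding strong_weihrauch_le_def
  proof (intro exI conjI allI impI)
    show "computable_partial (\<lambda>q. if q \<in> Z then Some (udec (B q)) else None)" by (rule Hc)
    show "computable_partial (\<lambda>p. Some (K p))" by (rule Kc)
    fix G assume G: "is_realizer (seq_rep rho_R) rho_R BWT_dom BWT_val G"
    show "is_realizer \<delta> rho_Rn S f (\<lambda>p. Option.bind (Some (K p))
      (\<lambda>r. Option.bind (G r) (\<lambda>q. if q \<in> Z then Some (udec (B q)) else None)))"
      unfolding is_realizer_def
    proof (intro allI impI)
      fix p x assume p: "\<delta> p = Some x" and x: "x \<in> S"
      define s where "s k = real (bitsum (uenc (U p k)) k) / 4 ^ k" for k
      have "rval (code p k) = s k" for k
        by (simp add: rval_eq code_def pnum_def nnum_def s_def of_nat_diff)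
      then have "rho_R (\<lambda>j. K p (prod_encode (k, j))) = Some (s k)" for k
        by (simp add: K_def rho_R_const)
      then have "seq_rep rho_R (K p) = Some s" by (simp add: seq_rep_def)
      moreover have "s \<in> BWT_dom"
      proof -
        have "norm (s k) \<le> 1" for k
        proof -
          have "bitsum (uenc (U p k)) k < 4 ^ k" by (rule bitsum_less) (rule uenc_le_1)
          then have "real (bitsum (uenc (U p k)) k) \<le> real (4 ^ k)" by (intro of_nat_mono) simp
          then show ?thesis by (simp add: s_def)
        qed
        then show ?thesis by (auto simp: BWT_dom_def bounded_iff)
      qed
      ultimately obtain q z where q: "G (K p) = Some q" "rho_R q = Some z" "z \<in> BWT_val s"
        using G unfolding is_realizer_def by blast
      have qz: "\<bar>rval (q i) - z\<bar> \<le> (1/2) ^ i" for i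
        using cauchy_rep_SomeD(2)[of rval q z i] q(2) by (simp add: rho_R_def dist_real_def)
      have agree: "\<exists>\<^sub>\<infinity>k. \<forall>l\<le>i. B q l = uenc (U p k) l" for i
      proof -
        have "\<exists>\<^sub>\<infinity>k. dist (s k) z < 1 / (2 * 4 ^ (i + 2))"
          using q(3) by (simp add: BWT_val_def cluster_point_def)
        moreover have "\<forall>\<^sub>\<infinity>k. i < k" unfolding MOST_nat by blast
        ultimately have "\<exists>\<^sub>\<infinity>k. dist (s k) z < 1 / (2 * 4 ^ (i + 2)) \<and> i < k"
          by (rule INFM_conjI)
        then show ?thesis
        proof (rule INFM_mono)
          fix k assume k: "dist (s k) z < 1 / (2 * 4 ^ (i + 2)) \<and> i < k"
          show "\<forall>l\<le>i. B q l = uenc (U p k) l"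
          proof (intro allI impI)
            fix l assume l: "l \<le> i"
            have "\<bar>rval (q (2 * l + 5)) - z\<bar> \<le> (1/2) ^ (2 * l + 5)" by (rule qz)
            also have "(1/2 :: real) ^ (2 * l + 5) = 1 / (2 * 4 ^ (l + 2))"
              unfolding power_add power_mult by (simp add: power_one_over power2_eq_square)
            finally have 1: "\<bar>rval (q (2 * l + 5)) - z\<bar> \<le> 1 / (2 * 4 ^ (l + 2))" .
            have "1 / (2 * 4 ^ (i + 2)) \<le> 1 / (2 * 4 ^ (l + 2) :: real)"
              using l by (intro divide_left_mono mult_left_mono power_increasing) auto
            then have 2: "\<bar>s k - z\<bar> \<le> 1 / (2 * 4 ^ (l + 2))" using k by (simp add: dist_real_def)
            have "1 / (2 * 4 ^ (l + 2)) + 1 / (2 * 4 ^ (l + 2)) = 1 / (4 ^ (l + 2) :: real)" by simp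
            then have "\<bar>rval (q (2 * l + 5)) - s k\<bar> \<le> 1 / 4 ^ (l + 2)" using 1 2 by linarith
            then show "B q l = uenc (U p k) l" unfolding B_def s_def
              by (intro bitdec_eq) (use l k uenc_le_1 in auto)
          qed
        qed
      qed
      obtain M where M: "\<And>k. norm (ratvec_of_code (Y p k) :: real ^ 'n::enum) \<le> real M"
      proof -
        obtain R where "\<And>k. norm (ratvec_of_code (Y p k) :: real ^ 'n::enum) \<le> R"
          using bdd[OF p x] by (auto simp: bounded_iff)
        moreover obtain M where "R \<le> real M" using real_arch_simple by blast
        ultimately show ?thesis using that order_trans by blast
      qed
      \<comment> \<open>A bound on the rounded codes that is independent of \<open>k\<close>: by
        position \<open>zpos C (Suc m)\<close> every coding has completed its blocks up to
        \<open>m\<close>, whichever \<open>k\<close> the bits of the cluster point come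
        from.\<close>
      define C where "C m = vbound ?n (m + 2 + ?n) M" for m
      have UC: "U p k m \<le> C m" for k m
        unfolding U_eq vname_def C_def
        by (rule vcode_le) (use component_le_norm_cart M order_trans in blast)
      have agree_dec: "\<exists>\<^sub>\<infinity>k. \<forall>j\<le>m. udec (B q) j = U p k j" for m
        using agree[of "zpos C (Suc m)"]
      proof (rule INFM_mono)
        fix k assume k: "\<forall>l\<le>zpos C (Suc m). B q l = uenc (U p k) l"
        have "zpos (U p k) (Suc m) \<le> zpos C (Suc m)"
          unfolding zpos_def by (intro add_mono sum_mono UC) simp
        then show "\<forall>j\<le>m. udec (B q) j = U p k j"
          using k by (intro allI impI udec_eq[where m=m]) auto
      qed
      have "q \<in> Z" unfolding Z_def INFM_nat_le
      proof (intro CollectI allI)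
        fix m
        obtain k where k: "\<forall>l\<le>zpos C (Suc m). B q l = uenc (U p k) l"
          using INFM_EX[OF agree] by blast
        have "zpos (U p k) (Suc m) \<le> zpos C (Suc m)"
          unfolding zpos_def by (intro add_mono sum_mono UC) simp
        then have "B q (zpos (U p k) m + U p k m) = 0" using k by (simp add: zpos_Suc uenc_end)
        then show "\<exists>i\<ge>m. B q i = 0" using zpos_ge[of m "U p k"] by (intro exI[of _ "zpos (U p k) m + U p k m"]) auto
      qed
      define u where "u = udec (B q)"
      have cau: "dist (ratvec_of_code (u i) :: real ^ 'n::enum) (ratvec_of_code (u j)) \<le> (1/2) ^ i" if ij: "i \<le> j" for i j
      proof -
        obtain k where k: "\<forall>l\<le>j. u l = U p k l" using INFM_EX[OF agree_dec] u_def by blast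
        then have "dist (ratvec_of_code (u i) :: real ^ 'n::enum) (ratvec_of_code (u j)) \<le> (1/2) ^ (i + 1)"
          using vname_cauchy[OF ij, of "ratvec_of_code (Y p k)"] ij by (simp add: U_eq)
        also have "\<dots> \<le> (1/2) ^ i" by simp
        finally show ?thesis .
      qed
      obtain y where y: "(\<lambda>i. ratvec_of_code (u i)) \<longlonglongrightarrow> (y :: real ^ 'n::enum)" "cauchy_rep ratvec_of_code u = Some y"
        using cauchy_rep_limit[of ratvec_of_code u] cau by blast
      have "\<exists>\<^sub>\<infinity>k. dist (ratvec_of_code (Y p k)) (ratvec_of_code (u m) :: real ^ 'n::enum) \<le> (1/2) ^ m" for m
        using agree_dec[of m]
      proof (rule INFM_mono)
        fix k assume "\<forall>j\<le>m. udec (B q) j = U p k j"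
        then have "u m = vname (ratvec_of_code (Y p k) :: real ^ 'n::enum) m" by (simp add: u_def U_eq)
        then have "dist (ratvec_of_code (Y p k)) (ratvec_of_code (u m) :: real ^ 'n::enum) \<le> (1/2) ^ (m + 2)"
          using vname_dist[of "ratvec_of_code (Y p k)" m] by (simp add: dist_commute)
        also have "\<dots> \<le> (1/2) ^ m" by (rule power_decreasing) auto
        finally show "dist (ratvec_of_code (Y p k)) (ratvec_of_code (u m) :: real ^ 'n::enum) \<le> (1/2) ^ m" .
      qed
      then obtain \<phi> where \<phi>: "strict_mono \<phi>"
        "\<And>m. dist (ratvec_of_code (Y p (\<phi> m))) (ratvec_of_code (u m) :: real ^ 'n::enum) \<le> (1/2) ^ m"
        using diagonal_subseq[of "\<lambda>m k. dist (ratvec_of_code (Y p k)) (ratvec_of_code (u m) :: real ^ 'n::enum) \<le> (1/2) ^ m"] by blast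
      have le: "dist (ratvec_of_code (Y p (\<phi> m))) y \<le> (1/2) ^ m + dist (ratvec_of_code (u m)) y" for m
        using \<phi>(2)[of m] dist_triangle[of "ratvec_of_code (Y p (\<phi> m))" y "ratvec_of_code (u m)"] by linarith
      have "(\<lambda>m. (1/2) ^ m + dist (ratvec_of_code (u m)) y) \<longlonglongrightarrow> 0 + 0"
        using y(1) by (intro tendsto_add LIMSEQ_realpow_zero) (auto simp flip: tendsto_dist_iff)
      then have lim: "(\<lambda>m. (1/2) ^ m + dist (ratvec_of_code (u m)) y) \<longlonglongrightarrow> 0" by (simp only: add_0)
      have "(\<lambda>m. dist (ratvec_of_code (Y p (\<phi> m))) y) \<longlonglongrightarrow> 0"
        by (rule Lim_null_comparison[OF _ lim]) (simp add: le)
      then have "(\<lambda>m. ratvec_of_code (Y p (\<phi> m))) \<longlonglongrightarrow> y" by (rule tendsto_dist_iff[THEN iffD2])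
      then have "y \<in> f x" by (rule sol[OF p x \<phi>(1)])
      then show "\<exists>q' y. Option.bind (Some (K p)) (\<lambda>r. Option.bind (G r)
          (\<lambda>q. if q \<in> Z then Some (udec (B q)) else None)) = Some q' \<and> rho_Rn q' = Some y \<and> y \<in> f x"
        using q(1) \<open>q \<in> Z\<close> y(2) by (auto simp: rho_Rn_def u_def)
    qed
  qed
qed

subsection \<open>Projection onto closed sets given by negative or positive information\<close>

definition argmin :: "(nat \<Rightarrow> nat) \<Rightarrow> nat \<Rightarrow> nat" where
  "argmin c = rec_nat 0 (\<lambda>k r. if c k < c r then k else r)"

lemma argmin_le: "i < N \<Longrightarrow> c (argmin c N) \<le> c i"
proof (induction N)
  case (Suc N)
  then show ?case by (cases "i = N") (auto simp: argmin_def)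
qed simp

lemma cr_argmin [cr_intros]:
  assumes "comp_rel E D (Suc m) (\<lambda>p ys. c p (hd ys) (tl ys))" "comp_rel E D m t"
  shows "comp_rel E D m (\<lambda>p xs. argmin (\<lambda>i. c p i xs) (t p xs))"
  unfolding argmin_def by (intro cr_intros assms cr_skip assms(1)[THEN cr_tl]; simp)

definition ctr :: "nat \<Rightarrow> nat" where "ctr c = fst (prod_decode c)"
definition rad :: "nat \<Rightarrow> nat" where "rad c = snd (prod_decode c)"

lemma cr_ctr [cr_intros]: "comp_rel E D m f \<Longrightarrow> comp_rel E D m (\<lambda>p xs. ctr (f p xs))"
  unfolding ctr_def by (rule cr_intros)

lemma cr_rad [cr_intros]: "comp_rel E D m f \<Longrightarrow> comp_rel E D m (\<lambda>p xs. rad (f p xs))"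
  unfolding rad_def by (rule cr_intros)

lemma basic_ball_eq: "basic_ball c = ball (ratvec_of_code (ctr c)) \<bar>rval (rad c)\<bar>"
  by (simp add: basic_ball_def ctr_def rad_def split_beta abs_if of_rat_minus)

lemma scale_le:
  "a \<le> b \<Longrightarrow> real a * (1/2) ^ l \<le> real b * (1/2) ^ l"
  by (simp add: mult_right_mono)

lemma scaled: "(2 ^ l * t) * (1/2) ^ l = (t :: real)"
  by (simp add: power_one_over)

lemma idist_scaled:
  fixes a b :: nat
  defines "n \<equiv> CARD('n::enum)" and "d \<equiv> dist (ratvec_of_code a :: real ^ 'n::enum) (ratvec_of_code b)"
  shows "real (idist n l a b) * (1/2) ^ l \<le> d + (2 * real n + 1) * (1/2) ^ l"
    and "d \<le> real (idist n l a b) * (1/2) ^ l + (2 * real n + 1) * (1/2) ^ l"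
proof -
  have "\<bar>real (idist n l a b) - 2 ^ l * d\<bar> \<le> 2 * real n + 1"
    unfolding n_def d_def by (rule idist_bound)
  then have "real (idist n l a b) \<le> 2 ^ l * d + (2 * real n + 1)" "2 ^ l * d \<le> real (idist n l a b) + (2 * real n + 1)"
    by linarith+
  then have "real (idist n l a b) * (1/2) ^ l \<le> (2 ^ l * d + (2 * real n + 1)) * (1/2) ^ l"
    "2 ^ l * d * (1/2) ^ l \<le> (real (idist n l a b) + (2 * real n + 1)) * (1/2) ^ l"
    by (intro mult_right_mono; simp)+
  then show "real (idist n l a b) * (1/2) ^ l \<le> d + (2 * real n + 1) * (1/2) ^ l"
    "d \<le> real (idist n l a b) * (1/2) ^ l + (2 * real n + 1) * (1/2) ^ l"
    by (simp_all only: distrib_right scaled)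
qed

lemma iabs_scaled:
  "real (iabs l b) * (1/2) ^ l \<le> \<bar>rval b\<bar>" "\<bar>rval b\<bar> \<le> real (iabs l b) * (1/2) ^ l + (1/2) ^ l"
proof -
  have "real (iabs l b) * (1/2) ^ l \<le> (2 ^ l * \<bar>rval b\<bar>) * (1/2) ^ l"
    "(2 ^ l * \<bar>rval b\<bar>) * (1/2) ^ l \<le> (real (iabs l b) + 1) * (1/2) ^ l"
    by (intro mult_right_mono iabs_bound; simp)+
  then show "real (iabs l b) * (1/2) ^ l \<le> \<bar>rval b\<bar>" "\<bar>rval b\<bar> \<le> real (iabs l b) * (1/2) ^ l + (1/2) ^ l"
    by (simp_all only: distrib_right scaled mult_1)
qed

lemma bounded_range_eventually:
  fixes Y :: "nat \<Rightarrow> 'a::metric_space"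
  assumes "\<And>k. k0 \<le> k \<Longrightarrow> dist x (Y k) \<le> C"
  shows "bounded (range Y)"
proof -
  have "Y k \<in> Y ` {..<k0} \<union> cball x C" for k
    using assms[of k] by (cases "k < k0") auto
  then have "range Y \<subseteq> Y ` {..<k0} \<union> cball x C" by blast
  moreover have "bounded (Y ` {..<k0} \<union> cball x C)" by (simp add: finite_imp_bounded)
  ultimately show ?thesis by (rule bounded_subset[rotated])
qed

text \<open>Turns inequalities that hold up to a multiple of \<open>2 ^ (- k)\<close> into exact
  ones; all rounding errors disappear here.\<close>

lemma limit_le:
  fixes f g :: "nat \<Rightarrow> real"
  assumes "f \<longlonglongrightarrow> a" "g \<longlonglongrightarrow> b" "strict_mono \<phi>" "\<And>k. k0 \<le> k \<Longrightarrow> f k \<le> g k + C * (1/2) ^ \<phi> k"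
  shows "a \<le> b"
proof -
  have "(\<lambda>k. (1/2 :: real) ^ \<phi> k) \<longlonglongrightarrow> 0"
    using LIMSEQ_subseq_LIMSEQ[OF LIMSEQ_realpow_zero[of "1/2"] assms(3)] by (simp add: comp_def)
  then have "(\<lambda>k. g k + C * (1/2) ^ \<phi> k) \<longlonglongrightarrow> b + C * 0" by (intro tendsto_intros assms)
  then show ?thesis using LIMSEQ_le[OF assms(1), of "\<lambda>k. g k + C * (1/2) ^ \<phi> k"] assms(4) by auto
qed

text \<open>Both hypotheses are closed conditions on \<open>y\<close>, so they can be verified in a
  limit. The first keeps \<open>y\<close> out of all removed open balls, and
  \<open>infdist x A \<le> dist x y\<close> then comes for free.\<close>

lemma proj_points_neg:
  assumes "\<And>i. \<bar>rval (rad (e i))\<bar> \<le> dist y (ratvec_of_code (ctr (e i)))"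
    "dist x y \<le> infdist x A" "A = - (\<Union>i. basic_ball (e i))"
  shows "y \<in> proj_points (x, A)"
proof -
  have "y \<in> A" unfolding assms(3) basic_ball_eq using assms(1) by (auto simp: dist_commute not_less)
  then show ?thesis using assms(2) infdist_le[of y A x] by (simp add: proj_points_def)
qed

lemma proj_points_ex:
  fixes A :: "(real ^ 'n::enum) set"
  assumes "closed A" "A \<noteq> {}"
  obtains a where "a \<in> A" "dist x a = infdist x A"
proof -
  obtain a where "a \<in> A" "infdist x A = dist x a" by (rule infdist_attains_inf[OF assms])
  then show ?thesis using that by metis
qed

text \<open>The tolerance consists of \<open>2n + 1\<close> for the rounding in \<open>idist\<close>
  and 1 for the distance from \<open>a\<close> to the point coded by \<open>c\<close>, with
  \<open>n\<close> the dimension; \<open>iabs\<close> rounds down and costs nothing in this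
  direction.\<close>

lemma iabs_le_idistI:
  fixes a :: "real ^ 'n::enum"
  assumes "a \<notin> basic_ball e" "dist (ratvec_of_code c) a \<le> (1/2) ^ k"
  shows "iabs k (rad e) \<le> idist (CARD('n)) k c (ctr e) + (2 * CARD('n) + 2)"
proof -
  let ?n = "CARD('n)"
  have "\<bar>rval (rad e)\<bar> \<le> dist a (ratvec_of_code (ctr e))"
    using assms(1) by (auto simp: basic_ball_eq dist_commute not_less)
  also have "\<dots> \<le> dist (ratvec_of_code c :: real ^ 'n::enum) (ratvec_of_code (ctr e)) + dist (ratvec_of_code c) a"
    using dist_triangle[of a "ratvec_of_code (ctr e)" "ratvec_of_code c"] by (simp add: dist_commute)
  finally have "real (iabs k (rad e)) * (1/2) ^ k \<le> (real (idist ?n k c (ctr e)) + (2 * real ?n + 2)) * (1/2) ^ k"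
    using assms(2) iabs_scaled(1)[of k "rad e"] idist_scaled(2)[where 'n='n, of c "ctr e" k]
    by (simp add: algebra_simps)
  then have "real (iabs k (rad e)) \<le> real (idist ?n k c (ctr e) + (2 * ?n + 2))"
    by (subst (asm) mult_le_cancel_right_pos) simp_all
  then show ?thesis by (simp only: of_nat_le_iff)
qed

text \<open>The price of acceptance: the tolerance \<open>2n + 2\<close>, plus 1 for
  \<open>iabs\<close> and \<open>2n + 1\<close> for \<open>idist\<close>.\<close>

lemma iabs_le_idistD:
  assumes "iabs k (rad e) \<le> idist (CARD('n)) k c (ctr e) + (2 * CARD('n) + 2)"
  shows "\<bar>rval (rad e)\<bar> \<le> dist (ratvec_of_code c :: real ^ 'n::enum) (ratvec_of_code (ctr e))
    + (4 * real (CARD('n)) + 4) * (1/2) ^ k"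
  using scale_le[OF assms, of k] iabs_scaled(2)[of "rad e" k] idist_scaled(1)[where 'n='n, of k c "ctr e"]
  by (simp add: algebra_simps)

section \<open>Minimisers for negative information\<close>

definition elig :: "nat \<Rightarrow> baire \<Rightarrow> nat \<Rightarrow> nat \<Rightarrow> bool" where
  "elig n p k c \<longleftrightarrow> (\<forall>i<k. iabs k (rad (p (2 * i + 1))) \<le> idist n k c (ctr (p (2 * i + 1))) + (2 * n + 2))"

text \<open>The stage-\<open>k\<close> candidates are the codes of a \<open>2 ^ (- k)\<close>-net of the cube of radius \<open>k\<close>; a
  candidate inside one of the first \<open>k\<close> removed balls pays a penalty that exceeds
  every fixed distance once \<open>k\<close> is large.\<close>

definition negcost :: "nat \<Rightarrow> baire \<Rightarrow> nat \<Rightarrow> nat \<Rightarrow> nat" where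
  "negcost n p k c = idist n k (p (2 * k)) c + (if elig n p k c then 0 else k * 2 ^ k)"

definition negproj :: "nat \<Rightarrow> baire \<Rightarrow> nat \<Rightarrow> nat" where
  "negproj n p k = argmin (negcost n p k) (Suc (vbound n (k + n) k))"

lemma cr_negproj: "comp_rel prefix_code D 1 (\<lambda>p xs. negproj n p (xs ! 0))"
  unfolding negproj_def negcost_def elig_def by (intro cr_intros; simp)

lemma elig_near:
  fixes a :: "real ^ 'n::enum"
  assumes "a \<notin> (\<Union>i. basic_ball (p (2 * i + 1)))" "dist (ratvec_of_code c) a \<le> (1/2) ^ k"
  shows "elig (CARD('n)) p k c"
  unfolding elig_def using assms by (intro allI impI iabs_le_idistI) auto

lemma elig_dest:
  assumes "elig (CARD('n)) p k c" "i < k"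
  shows "\<bar>rval (rad (p (2 * i + 1)))\<bar> \<le> dist (ratvec_of_code c :: real ^ 'n::enum) (ratvec_of_code (ctr (p (2 * i + 1))))
    + (4 * real (CARD('n)) + 4) * (1/2) ^ k"
  using assms by (intro iabs_le_idistD) (simp add: elig_def)

text \<open>The net point of \<open>a\<close> is an eligible competitor, so the scaled cost of the
  minimiser is hardly more than \<open>dist x a\<close>. The scaled penalty is \<open>k\<close>;
  once it exceeds this value the minimiser must be eligible itself, and its cost is the true
  distance up to rounding.\<close>

lemma negproj_bound:
  fixes x :: "real ^ 'n::enum"
  assumes x: "rho_Rn (\<lambda>i. p (2 * i)) = Some x" and a: "a \<notin> (\<Union>i. basic_ball (p (2 * i + 1)))"
  obtains k0 where "\<And>k. k0 \<le> k \<Longrightarrow> elig (CARD('n)) p k (negproj (CARD('n)) p k) \<and>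
    dist x (ratvec_of_code (negproj (CARD('n)) p k)) \<le> dist x a + (4 * real (CARD('n)) + 5) * (1/2) ^ k"
proof -
  let ?n = "CARD('n)"
  \<comment> \<open>\<open>norm a\<close> places \<open>a\<close> in the cube of radius
    \<open>k\<close>; the other terms exceed the scaled cost of its net point, so that the penalty
    is prohibitive.\<close>
  obtain k0 where k0: "norm a + dist x a + 2 * real ?n + 3 < real k0" using reals_Archimedean2 by blast
  show ?thesis
  proof (rule that[of k0])
    fix k assume k: "k0 \<le> k"
    then have rk: "norm a + dist x a + 2 * real ?n + 3 < real k" using k0 by linarith
    define \<epsilon> where "\<epsilon> = (1/2 :: real) ^ k"
    have \<epsilon>: "0 < \<epsilon>" "\<epsilon> \<le> 1" by (auto simp: \<epsilon>_def power_le_one)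
    define Y where "Y = negproj ?n p k"
    define c where "c = vcode (k + ?n) a"
    have xk: "dist (ratvec_of_code (p (2 * k))) x \<le> \<epsilon>"
      using cauchy_rep_SomeD(2)[of ratvec_of_code "\<lambda>i. p (2 * i)" x k] x by (simp add: rho_Rn_def \<epsilon>_def)
    have ca: "dist (ratvec_of_code c) a \<le> \<epsilon>" unfolding c_def \<epsilon>_def using vcode_dist_add[of k a] by (simp add: power_one_over)
    have "\<bar>a $ i\<bar> \<le> real k" for i
      using component_le_norm_cart[of a i] rk zero_le_dist[of x a] by linarith
    then have "c \<le> vbound ?n (k + ?n) k" unfolding c_def by (rule vcode_le)
    then have "negcost ?n p k Y \<le> negcost ?n p k c"
      unfolding Y_def negproj_def by (intro argmin_le) simp
    also have "\<dots> = idist ?n k (p (2 * k)) c" using elig_near[OF a] ca by (simp add: negcost_def \<epsilon>_def)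
    finally have cost: "real (negcost ?n p k Y) * \<epsilon> \<le> real (idist ?n k (p (2 * k)) c) * \<epsilon>"
      unfolding \<epsilon>_def by (rule scale_le)
    have "dist (ratvec_of_code (p (2 * k)) :: real ^ 'n::enum) (ratvec_of_code c) \<le> dist x a + 2 * \<epsilon>"
      using dist_triangle[of "ratvec_of_code (p (2 * k))" "ratvec_of_code c" x]
        dist_triangle[of x "ratvec_of_code c" a] xk ca by (simp add: dist_commute)
    then have cost2: "real (negcost ?n p k Y) * \<epsilon> \<le> dist x a + (2 * real ?n + 3) * \<epsilon>"
      using cost idist_scaled(1)[where 'n='n, of k "p (2 * k)" c] unfolding \<epsilon>_def[symmetric]
      by (simp add: algebra_simps)
    have el: "elig ?n p k Y"
    proof (rule ccontr)
      assume "\<not> elig ?n p k Y"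
      then have "k * 2 ^ k \<le> negcost ?n p k Y" by (simp add: negcost_def)
      then have "real (k * 2 ^ k) * \<epsilon> \<le> real (negcost ?n p k Y) * \<epsilon>" unfolding \<epsilon>_def by (rule scale_le)
      also have "real (k * 2 ^ k) * \<epsilon> = real k" by (simp add: \<epsilon>_def power_one_over)
      also note cost2
      also have "dist x a + (2 * real ?n + 3) * \<epsilon> \<le> dist x a + (2 * real ?n + 3) * 1"
        using \<epsilon> by (intro add_left_mono mult_left_mono) auto
      finally have "real k \<le> dist x a + (2 * real ?n + 3)" by simp
      then show False using rk norm_ge_zero[of a] by linarith
    qed
    have "dist (ratvec_of_code (p (2 * k)) :: real ^ 'n::enum) (ratvec_of_code Y) \<le> dist x a + (4 * real ?n + 4) * \<epsilon>"
      using cost2 el idist_scaled(2)[where 'n='n, of "p (2 * k)" Y k] unfolding \<epsilon>_def[symmetric]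
      by (simp add: algebra_simps negcost_def)
    then have "dist x (ratvec_of_code Y) \<le> dist x a + (4 * real ?n + 5) * \<epsilon>"
      using xk dist_triangle[of x "ratvec_of_code Y" "ratvec_of_code (p (2 * k))"]
      by (simp add: dist_commute algebra_simps)
    then show "elig ?n p k (negproj ?n p k) \<and> dist x (ratvec_of_code (negproj ?n p k)) \<le> dist x a + (4 * real ?n + 5) * (1/2) ^ k"
      using el by (simp add: Y_def \<epsilon>_def)
  qed
qed

lemma pair_rep_SomeD:
  assumes "pair_rep \<delta>1 \<delta>2 p = Some (x, y)"
  shows "\<delta>1 (\<lambda>i. p (2 * i)) = Some x" "\<delta>2 (\<lambda>i. p (2 * i + 1)) = Some y"
  using assms by (auto simp: pair_rep_def split: option.splits)

lemma neg_rep_SomeD: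
  assumes "neg_rep p = Some A"
  shows "A = - (\<Union>i. basic_ball (p i))" "closed A"
proof -
  show A: "A = - (\<Union>i. basic_ball (p i))" using assms by (simp add: neg_rep_def)
  show "closed A" unfolding A closed_def by (auto simp: basic_ball_eq)
qed

lemma proj_neg_le_BWT:
  "strong_weihrauch_le (pair_rep (rho_Rn :: baire \<Rightarrow> (real ^ 'n::enum) option) neg_rep) rho_Rn proj_dom proj_points
     (seq_rep rho_R) rho_R BWT_dom BWT_val"
proof (rule BWT_reduction[where Y="negproj (CARD('n))", OF cr_negproj])
  let ?n = "CARD('n)"
  let ?Y = "\<lambda>p k. ratvec_of_code (negproj ?n p k) :: real ^ 'n::enum"
  fix p and xA :: "(real ^ 'n::enum) \<times> (real ^ 'n::enum) set"
  assume "pair_rep rho_Rn neg_rep p = Some xA" "xA \<in> proj_dom"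
  then obtain x A where xA: "xA = (x, A)" "pair_rep rho_Rn neg_rep p = Some (x, A)" "A \<noteq> {}"
    by (cases xA) (auto simp: proj_dom_def)
  note x = pair_rep_SomeD(1)[OF xA(2)] and A = neg_rep_SomeD[OF pair_rep_SomeD(2)[OF xA(2)]]
  obtain a where a: "a \<in> A" "dist x a = infdist x A" using proj_points_ex[OF A(2) xA(3)] by blast
  then have "a \<notin> (\<Union>i. basic_ball (p (2 * i + 1)))" using A(1) by blast
  then obtain k0 where k0: "\<And>k. k0 \<le> k \<Longrightarrow> elig ?n p k (negproj ?n p k) \<and>
      dist x (?Y p k) \<le> infdist x A + (4 * real ?n + 5) * (1/2) ^ k"
    using negproj_bound[OF x] a(2) by metis
  show "bounded (range (?Y p))"
  proof (rule bounded_range_eventually)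
    fix k assume "k0 \<le> k"
    then have "dist x (?Y p k) \<le> infdist x A + (4 * real ?n + 5) * (1/2) ^ k" using k0 by blast
    also have "\<dots> \<le> infdist x A + (4 * real ?n + 5) * 1"
      by (intro add_left_mono mult_left_mono) (auto simp: power_le_one)
    finally show "dist x (?Y p k) \<le> infdist x A + (4 * real ?n + 5) * 1" .
  qed
  fix \<phi> :: "nat \<Rightarrow> nat" and y assume \<phi>: "strict_mono \<phi>" and y: "(\<lambda>k. ?Y p (\<phi> k)) \<longlonglongrightarrow> y"
  have \<phi>k: "k \<le> \<phi> k" for k by (rule strict_mono_imp_increasing[OF \<phi>])
  show "y \<in> proj_points xA" unfolding xA(1)
  proof (rule proj_points_neg[OF _ _ A(1)])
    show "dist x y \<le> infdist x A"
      by (rule limit_le[OF tendsto_dist[OF tendsto_const y] tendsto_const \<phi>, of k0])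
        (use k0 \<phi>k le_trans in blast)
    \<comment> \<open>Ball \<open>i\<close> is tested at every stage above \<open>i\<close>, which
      explains the threshold \<open>Suc i\<close>.\<close>
    show "\<bar>rval (rad (p (2 * i + 1)))\<bar> \<le> dist y (ratvec_of_code (ctr (p (2 * i + 1))))" for i
    proof (rule limit_le[OF tendsto_const tendsto_dist[OF y tendsto_const] \<phi>, of "max k0 (Suc i)"])
      fix k assume "max k0 (Suc i) \<le> k"
      then have "k0 \<le> \<phi> k" "i < \<phi> k" using \<phi>k[of k] by auto
      then show "\<bar>rval (rad (p (2 * i + 1)))\<bar> \<le> dist (?Y p (\<phi> k)) (ratvec_of_code (ctr (p (2 * i + 1))))
        + (4 * real ?n + 4) * (1/2) ^ \<phi> k" using k0 elig_dest by blast
    qed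
  qed
qed

text \<open>The weight 2 on the radius forces it to 0 along minimisers: a ball meeting \<open>A\<close> satisfies
  \<open>d(x, A) \<le> d(x, c) + r\<close>, while the infimum of \<open>d(x, c) + 2 r\<close> is \<open>d(x, A)\<close>.\<close>

definition poscost :: "nat \<Rightarrow> baire \<Rightarrow> nat \<Rightarrow> nat \<Rightarrow> nat" where
  "poscost n p k i = idist n k (p (2 * k)) (ctr (p (2 * i + 1))) + 2 * iabs k (rad (p (2 * i + 1)))"

definition posproj :: "nat \<Rightarrow> baire \<Rightarrow> nat \<Rightarrow> nat" where
  "posproj n p k = argmin (poscost n p k) k"

lemma cr_posproj: "comp_rel prefix_code D 1 (\<lambda>p xs. ctr (p (2 * posproj n p (xs ! 0) + 1)))"
  unfolding posproj_def poscost_def by (intro cr_intros; simp)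

lemma pos_rep_SomeD:
  assumes "pos_rep p = Some A"
  shows "closed A" "range p = {c. basic_ball c \<inter> A \<noteq> {}}"
proof -
  have "pos_name p A" using assms by (auto simp: pos_rep_def intro: someI split: if_splits)
  then show "closed A" "range p = {c. basic_ball c \<inter> A \<noteq> {}}" by (auto simp: pos_name_def)
qed

lemma pos_rep_lower:
  assumes "pos_rep p = Some A"
  shows "infdist x A \<le> dist x (ratvec_of_code (ctr (p i))) + \<bar>rval (rad (p i))\<bar>"
    "infdist (ratvec_of_code (ctr (p i))) A \<le> \<bar>rval (rad (p i))\<bar>"
proof -
  have "basic_ball (p i) \<inter> A \<noteq> {}" using pos_rep_SomeD(2)[OF assms] by blast
  then obtain z where z: "z \<in> A" "dist (ratvec_of_code (ctr (p i))) z < \<bar>rval (rad (p i))\<bar>"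
    by (auto simp: basic_ball_eq)
  show "infdist (ratvec_of_code (ctr (p i))) A \<le> \<bar>rval (rad (p i))\<bar>"
    using infdist_le[OF z(1)] z(2) by (meson less_imp_le order_trans)
  show "infdist x A \<le> dist x (ratvec_of_code (ctr (p i))) + \<bar>rval (rad (p i))\<bar>"
    using infdist_le[OF z(1), of x] z(2) dist_triangle[of x z "ratvec_of_code (ctr (p i))"] by linarith
qed

text \<open>A positive name lists every basic ball that meets \<open>A\<close>, among them
  arbitrarily small ones about rational points near \<open>a\<close>.\<close>

lemma pos_rep_upper:
  assumes p: "pos_rep p = Some A" and a: "a \<in> A" and "0 < \<eta>"
  obtains i where "dist x (ratvec_of_code (ctr (p i))) + 2 * \<bar>rval (rad (p i))\<bar> \<le> dist x (a :: real ^ 'n::enum) + \<eta>"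
proof -
  \<comment> \<open>Three thirds of \<open>\<eta>\<close>: one for the centre, two for the radius,
    which counts twice.\<close>
  obtain m where m: "(1/2) ^ m < \<eta> / 3" using real_arch_pow_inv[of "\<eta> / 3" "1/2"] assms(3) by auto
  \<comment> \<open>Numerator code 2 is the integer 1, so the radius is \<open>1 / 2 ^ m\<close>;
    the centre is half as far from \<open>a\<close>, hence \<open>a\<close> lies strictly
    inside.\<close>
  define c where "c = prod_encode (vcode (m + 1 + CARD('n)) a, prod_encode (2, 2 ^ m - 1))"
  have r: "rval (rad c) = (1/2) ^ m"
    by (simp add: rval_eq rad_def c_def pnum_def nnum_def of_nat_diff power_one_over)
  have d: "dist (ratvec_of_code (ctr c)) a \<le> (1/2) ^ (m + 1)"
    using vcode_dist_add[of "m + 1" a] by (simp add: ctr_def c_def power_one_over)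
  also have "\<dots> < (1/2) ^ m" by simp
  finally have d': "dist (ratvec_of_code (ctr c)) a < (1/2) ^ m" .
  then have "a \<in> basic_ball c" by (simp add: basic_ball_eq r)
  then have "c \<in> range p" unfolding pos_rep_SomeD(2)[OF p] using a by blast
  then obtain i where i: "p i = c" by blast
  have "dist x (ratvec_of_code (ctr c)) \<le> dist x a + (1/2) ^ m"
    using dist_triangle[of x "ratvec_of_code (ctr c)" a] d' by (simp add: dist_commute)
  then show ?thesis using that[of i] m by (simp add: i r)
qed

lemma posproj_bound:
  fixes x :: "real ^ 'n::enum"
  assumes p: "pair_rep rho_Rn pos_rep p = Some (x, A)" and A: "A \<noteq> {}" and "0 < \<eta>"
  obtains k0 where "\<And>k. k0 \<le> k \<Longrightarrow>
    dist x (ratvec_of_code (ctr (p (2 * posproj (CARD('n)) p k + 1)))) \<le> infdist x A + \<eta> \<and>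
    infdist (ratvec_of_code (ctr (p (2 * posproj (CARD('n)) p k + 1)))) A \<le> \<eta>"
proof -
  let ?n = "CARD('n)"
  let ?c = "\<lambda>i. ratvec_of_code (ctr (p (2 * i + 1))) :: real ^ 'n::enum" and ?r = "\<lambda>i. \<bar>rval (rad (p (2 * i + 1)))\<bar>"
  note x = pair_rep_SomeD(1)[OF p] and pA = pair_rep_SomeD(2)[OF p]
  obtain a where a: "a \<in> A" "dist x a = infdist x A" using proj_points_ex[OF pos_rep_SomeD(1)[OF pA] A] by blast
  obtain i where i: "dist x (?c i) + 2 * ?r i \<le> infdist x A + \<eta> / 2"
    using pos_rep_upper[OF pA a(1), of "\<eta> / 2" x] a(2) \<open>0 < \<eta>\<close> by auto
  \<comment> \<open>\<open>4n + 6\<close> collects all errors in comparing two costs: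
    \<open>2n + 1\<close> twice for \<open>idist\<close>, 2 for the doubled \<open>iabs\<close>, and
    1 twice for replacing \<open>x\<close> by its approximation.\<close>
  obtain m where m: "(1/2) ^ m < \<eta> / 2 / (4 * real ?n + 6)"
    using real_arch_pow_inv[of "\<eta> / 2 / (4 * real ?n + 6)" "1/2"] \<open>0 < \<eta>\<close> by auto
  show ?thesis
  proof (rule that[of "max (Suc i) m"])
    fix k assume k: "max (Suc i) m \<le> k"
    define \<epsilon> where "\<epsilon> = (1/2 :: real) ^ k"
    have "\<epsilon> \<le> (1/2) ^ m" unfolding \<epsilon>_def using k by (intro power_decreasing) auto
    then have "\<epsilon> \<le> \<eta> / 2 / (4 * real ?n + 6)" using m by linarith
    then have \<epsilon>: "(4 * real ?n + 6) * \<epsilon> \<le> \<eta> / 2" by (simp add: field_simps)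
    define b where "b = posproj ?n p k"
    have xk: "dist (ratvec_of_code (p (2 * k))) x \<le> \<epsilon>"
      using cauchy_rep_SomeD(2)[of ratvec_of_code "\<lambda>i. p (2 * i)" x k] x by (simp add: rho_Rn_def \<epsilon>_def)
    have "poscost ?n p k b \<le> poscost ?n p k i" unfolding b_def posproj_def using k by (intro argmin_le) simp
    then have "real (poscost ?n p k b) * \<epsilon> \<le> real (poscost ?n p k i) * \<epsilon>" unfolding \<epsilon>_def by (rule scale_le)
    moreover have "dist (ratvec_of_code (p (2 * k))) (?c b) + 2 * ?r b \<le> real (poscost ?n p k b) * \<epsilon> + (2 * real ?n + 3) * \<epsilon>"
      using idist_scaled(2)[where 'n='n, of "p (2 * k)" "ctr (p (2 * b + 1))" k] iabs_scaled(2)[of "rad (p (2 * b + 1))" k]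
      unfolding \<epsilon>_def[symmetric] poscost_def by (simp add: algebra_simps)
    moreover have "real (poscost ?n p k i) * \<epsilon> \<le> dist (ratvec_of_code (p (2 * k))) (?c i) + 2 * ?r i + (2 * real ?n + 1) * \<epsilon>"
      using idist_scaled(1)[where 'n='n, of k "p (2 * k)" "ctr (p (2 * i + 1))"] iabs_scaled(1)[of k "rad (p (2 * i + 1))"]
      unfolding \<epsilon>_def[symmetric] poscost_def by (simp add: algebra_simps)
    moreover have "dist x (?c b) \<le> dist (ratvec_of_code (p (2 * k))) (?c b) + \<epsilon>"
      using xk dist_triangle[of x "?c b" "ratvec_of_code (p (2 * k))"] by (simp add: dist_commute)
    moreover have "dist (ratvec_of_code (p (2 * k))) (?c i) \<le> dist x (?c i) + \<epsilon>"
      using xk dist_triangle[of "ratvec_of_code (p (2 * k))" "?c i" x] by simp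
    ultimately have main: "dist x (?c b) + 2 * ?r b \<le> infdist x A + \<eta>"
      using i \<epsilon> by (simp add: algebra_simps)
    \<comment> \<open>Subtracting this lower bound from the upper bound \<open>main\<close> leaves a
      radius of at most \<open>\<eta>\<close>, and the centre is no farther than the radius from
      \<open>A\<close>.\<close>
    have "infdist x A \<le> dist x (?c b) + ?r b" "infdist (?c b) A \<le> ?r b"
      using pos_rep_lower[OF pA] by auto
    then show "dist x (?c (posproj ?n p k)) \<le> infdist x A + \<eta> \<and> infdist (?c (posproj ?n p k)) A \<le> \<eta>"
      using main unfolding b_def[symmetric] by linarith
  qed
qed

lemma proj_pos_le_BWT:
  "strong_weihrauch_le (pair_rep (rho_Rn :: baire \<Rightarrow> (real ^ 'n::enum) option) pos_rep) rho_Rn proj_dom proj_points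
     (seq_rep rho_R) rho_R BWT_dom BWT_val"
proof (rule BWT_reduction[where Y="\<lambda>p k. ctr (p (2 * posproj (CARD('n)) p k + 1))", OF cr_posproj])
  let ?n = "CARD('n)"
  let ?Y = "\<lambda>p k. ratvec_of_code (ctr (p (2 * posproj ?n p k + 1))) :: real ^ 'n::enum"
  fix p and xA :: "(real ^ 'n::enum) \<times> (real ^ 'n::enum) set"
  assume "pair_rep rho_Rn pos_rep p = Some xA" "xA \<in> proj_dom"
  then obtain x A where xA: "xA = (x, A)" "pair_rep rho_Rn pos_rep p = Some (x, A)" "A \<noteq> {}"
    by (cases xA) (auto simp: proj_dom_def)
  note A = pos_rep_SomeD[OF pair_rep_SomeD(2)[OF xA(2)]]
  note bound = posproj_bound[OF xA(2,3)]
  obtain k0 where "\<And>k. k0 \<le> k \<Longrightarrow> dist x (?Y p k) \<le> infdist x A + 1 \<and> infdist (?Y p k) A \<le> 1"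
    using bound[OF zero_less_one] by blast
  then have "\<And>k. k0 \<le> k \<Longrightarrow> dist x (?Y p k) \<le> infdist x A + 1" by blast
  then show "bounded (range (?Y p))" by (rule bounded_range_eventually)
  fix \<phi> :: "nat \<Rightarrow> nat" and y assume \<phi>: "strict_mono \<phi>" and y: "(\<lambda>k. ?Y p (\<phi> k)) \<longlonglongrightarrow> y"
  have \<phi>k: "k \<le> \<phi> k" for k by (rule strict_mono_imp_increasing[OF \<phi>])
  have "dist x y \<le> infdist x A + \<eta> \<and> infdist y A \<le> \<eta>" if \<eta>: "0 < \<eta>" for \<eta>
  proof -
    obtain k0 where k0: "\<And>k. k0 \<le> k \<Longrightarrow> dist x (?Y p k) \<le> infdist x A + \<eta> \<and> infdist (?Y p k) A \<le> \<eta>"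
      using bound[OF \<eta>] by blast
    then have "\<forall>k\<ge>k0. dist x (?Y p (\<phi> k)) \<le> infdist x A + \<eta>" "\<forall>k\<ge>k0. infdist (?Y p (\<phi> k)) A \<le> \<eta>"
      using \<phi>k le_trans by blast+
    then show ?thesis
      using LIMSEQ_le_const2[OF tendsto_dist[OF tendsto_const y]] LIMSEQ_le_const2[OF tendsto_infdist[OF y]] by blast
  qed
  then have "dist x y \<le> infdist x A" "infdist y A \<le> 0"
    using field_le_epsilon[of "dist x y" "infdist x A"] field_le_epsilon[of "infdist y A" 0] by auto
  moreover from this have "y \<in> A"
    using in_closed_iff_infdist_zero[OF A(1) xA(3)] infdist_nonneg[of y A] by simp
  ultimately show "y \<in> proj_points xA"
    using infdist_le[of y A x] by (simp add: proj_points_def xA(1))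
qed

subsection \<open>Projection onto closed sets given by total information\<close>

text \<open>In names of \<open>(x, A)\<close> with total information, \<open>x\<close> sits at the positions \<open>2 k\<close>, the negative name
  of \<open>A\<close> at \<open>4 i + 1\<close> and its positive name at \<open>4 i + 3\<close>.\<close>

definition pbound :: "nat \<Rightarrow> baire \<Rightarrow> nat" where
  "pbound n p = idist n 0 0 (p 0) + idist n 0 (p 0) (ctr (p 3)) + iabs 0 (rad (p 3)) + (4 * n + 5)"

text \<open>Both conjuncts are decidable comparisons of naturals. They express that the point coded
  by \<open>v\<close> avoids the \<open>i\<close>-th removed ball and is no farther from
  \<open>x\<close> than the \<open>i\<close>-th ball meeting \<open>A\<close> allows.\<close>

definition vcond :: "nat \<Rightarrow> baire \<Rightarrow> nat \<Rightarrow> nat \<Rightarrow> nat \<Rightarrow> bool" where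
  "vcond n p m v i \<longleftrightarrow>
     iabs m (rad (p (4 * i + 1))) \<le> idist n m v (ctr (p (4 * i + 1))) + (2 * n + 2) \<and>
     idist n m (p (2 * m)) v \<le> idist n m (p (2 * m)) (ctr (p (4 * i + 3))) + iabs m (rad (p (4 * i + 3))) + (4 * n + 6)"

text \<open>Must accept distance \<open>(1/2) ^ (m + 1)\<close> and reject everything above
  \<open>(1/2) ^ m\<close>. At precision \<open>m + 2 * n + 3\<close> these are
  \<open>2 ^ (2 * n + 2)\<close> and \<open>2 ^ (2 * n + 3)\<close> units; the gap has room for two
  rounding errors of \<open>2 * n + 1\<close>, because
  \<open>2 * n + 1 \<le> 2 ^ (2 * n + 1)\<close>.\<close>

definition close :: "nat \<Rightarrow> nat \<Rightarrow> nat \<Rightarrow> nat \<Rightarrow> bool" where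
  "close n m v v' \<longleftrightarrow> idist n (m + 2 * n + 3) v v' \<le> 2 ^ (2 * n + 2) + (2 * n + 1)"

text \<open>A word of length \<open>L\<close> is kept as long as no block that it completes is seen to violate
  a constraint on names of projection points; the bound on the length of blocks, also
  of the last and incomplete one, excludes paths with finitely many zeros.\<close>

definition node :: "nat \<Rightarrow> baire \<Rightarrow> (nat \<Rightarrow> nat) \<Rightarrow> nat \<Rightarrow> bool" where
  "node n p \<beta> L \<longleftrightarrow>
     (\<forall>m<Suc (zcount \<beta> L). blen \<beta> L m \<le> vbound n (m + 2 + n) (pbound n p)) \<and>
     (\<forall>m<zcount \<beta> L. (\<forall>i<L. vcond n p m (blen \<beta> L m) i) \<and>
        (\<forall>m'<zcount \<beta> L. m \<le> m' \<longrightarrow> close n m (blen \<beta> L m) (blen \<beta> L m')))"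

lemma cr_zcount [cr_intros]:
  assumes "comp_rel E D (Suc m) (\<lambda>p ys. b p (hd ys) (tl ys))" "comp_rel E D m t"
  shows "comp_rel E D m (\<lambda>p xs. zcount (\<lambda>i. b p i xs) (t p xs))"
  unfolding zcount_def by (intro cr_intros assms)

lemma cr_blen [cr_intros]:
  assumes b: "comp_rel E D (Suc m) (\<lambda>p ys. b p (hd ys) (tl ys))" and "comp_rel E D m t" "comp_rel E D m f"
  shows "comp_rel E D m (\<lambda>p xs. blen (\<lambda>i. b p i xs) (t p xs) (f p xs))"
  unfolding blen_def by (intro cr_intros assms assms(3)[THEN cr_tl] cr_skip[OF b]; simp)

lemma cr_node:
  "comp_rel prefix_code D 1 (\<lambda>p xs. of_bool (node n p (\<lambda>i. lnth (xs ! 0) i) (llen (xs ! 0))))"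
  unfolding node_def vcond_def close_def pbound_def by (intro cr_intros; simp)

section \<open>The tree of words not yet refuted\<close>

lemma zcount_cong:
  assumes "\<And>i. i < L \<Longrightarrow> (\<beta> i = 0) = (\<beta>' i = 0)" "l \<le> L"
  shows "zcount \<beta> l = zcount \<beta>' l"
  unfolding zcount_def using assms by (intro sum.cong) auto

lemma blen_cong:
  assumes "\<And>i. i < L \<Longrightarrow> (\<beta> i = 0) = (\<beta>' i = 0)"
  shows "blen \<beta> L m = blen \<beta>' L m"
proof -
  have "zcount \<beta> i = zcount \<beta>' i" if "i < L" for i
    by (rule zcount_cong[where L=L]) (use assms that in auto)
  then show ?thesis unfolding blen_def using assms by (intro sum.cong) auto
qed

text \<open>Only vanishing of entries matters, as in \<open>bword\<close>; hence all codes of one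
  Boolean word get the same value, which \<open>tree_rep\<close> demands.\<close>

lemma node_cong:
  assumes "\<And>i. i < L \<Longrightarrow> (\<beta> i = 0) = (\<beta>' i = 0)"
  shows "node n p \<beta> L \<longleftrightarrow> node n p \<beta>' L"
proof -
  have "zcount \<beta> L = zcount \<beta>' L" by (rule zcount_cong[OF assms]) auto
  moreover have "blen \<beta> L m = blen \<beta>' L m" for m by (rule blen_cong[OF assms])
  ultimately show ?thesis unfolding node_def by simp
qed

lemma blen_stable:
  assumes "m < zcount \<beta> L" "L \<le> L'"
  shows "blen \<beta> L' m = blen \<beta> L m"
proof -
  have "i < L" if "zcount \<beta> i = m" for i
    using zcount_mono[of L i \<beta>] assms(1) that by (cases "i < L") auto
  then have "{i. i < L' \<and> \<beta> i \<noteq> 0 \<and> zcount \<beta> i = m} = {i. i < L \<and> \<beta> i \<noteq> 0 \<and> zcount \<beta> i = m}"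
    using assms(2) by (meson less_le_trans)
  then show ?thesis unfolding blen_card by simp
qed

text \<open>Longer words face more constraints: completed blocks keep their length, the open block
  can only grow, and the range of tested balls increases.\<close>

lemma node_prefix:
  assumes "node n p \<beta> L'" "L \<le> L'"
  shows "node n p \<beta> L"
proof -
  have z: "zcount \<beta> L \<le> zcount \<beta> L'" using assms(2) by (rule zcount_mono)
  have "blen \<beta> L m \<le> vbound n (m + 2 + n) (pbound n p)" if "m < Suc (zcount \<beta> L)" for m
    using blen_mono[OF assms(2), of \<beta> m] assms(1) that z unfolding node_def by (meson le_trans less_Suc_eq_le)
  moreover have "(\<forall>i<L. vcond n p m (blen \<beta> L m) i) \<and>
      (\<forall>m'<zcount \<beta> L. m \<le> m' \<longrightarrow> close n m (blen \<beta> L m) (blen \<beta> L m'))" if m: "m < zcount \<beta> L" for m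
  proof -
    have "m < zcount \<beta> L'" using m z by simp
    then have 1: "\<forall>i<L'. vcond n p m (blen \<beta> L' m) i"
      and 2: "\<forall>m'<zcount \<beta> L'. m \<le> m' \<longrightarrow> close n m (blen \<beta> L' m) (blen \<beta> L' m')"
      using assms(1) unfolding node_def by blast+
    have st: "blen \<beta> L' k = blen \<beta> L k" if "k < zcount \<beta> L" for k using that assms(2) by (rule blen_stable)
    show ?thesis
    proof (intro conjI allI impI)
      show "vcond n p m (blen \<beta> L m) i" if "i < L" for i using 1 st[OF m] that assms(2) by simp
      show "close n m (blen \<beta> L m) (blen \<beta> L m')" if "m' < zcount \<beta> L" "m \<le> m'" for m'
        using 2 st[OF m] st[OF that(1)] that z by (metis less_le_trans)
    qed
  qed
  ultimately show ?thesis unfolding node_def by blast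
qed

definition ptree :: "nat \<Rightarrow> baire \<Rightarrow> bool list set" where
  "ptree n p = {w. node n p (\<lambda>i. of_bool (w ! i)) (length w)}"

lemma is_tree_ptree: "is_tree (ptree n p)"
  unfolding is_tree_def ptree_def
proof (intro allI impI CollectI, unfold mem_Collect_eq)
  fix w v assume "node n p (\<lambda>i. of_bool ((w @ v) ! i)) (length (w @ v))"
  then have "node n p (\<lambda>i. of_bool ((w @ v) ! i)) (length w)" by (rule node_prefix) simp
  then show "node n p (\<lambda>i. of_bool (w ! i)) (length w)"
    by (rule node_cong[THEN iffD1, rotated]) (simp add: nth_append)
qed

lemma bword_ptree: "bword c \<in> ptree n p \<longleftrightarrow> node n p (lnth c) (llen c)"
  unfolding ptree_def mem_Collect_eq
  by (simp add: bword_def llen_decode) (rule node_cong, simp add: lnth_decode)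

lemma tree_rep_ptree: "tree_rep (\<lambda>c. of_bool (node n p (lnth c) (llen c))) = Some (ptree n p)"
proof -
  have sur: "\<exists>k. bword k = w" for w
    by (intro exI[of _ "list_encode (map of_bool w)"]) (simp add: bword_def comp_def)
  let ?K = "\<lambda>c. of_bool (node n p (lnth c) (llen c)) :: nat"
  have tree: "{bword k |k. ?K k = 1} = ptree n p"
    unfolding of_bool_eq_1_iff bword_ptree[symmetric] using sur by (auto, metis)
  have "?K k = ?K k'" if "bword k = bword k'" for k k'
    unfolding bword_ptree[symmetric] that by (rule refl)
  moreover have "?K k \<le> 1" for k by simp
  ultimately show ?thesis
    unfolding tree_rep_def tree using is_tree_ptree[of n p] by (intro if_P) blast
qed

text \<open>Sources of the tolerance \<open>4n + 6\<close>: \<open>2n + 1\<close> for each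
  \<open>idist\<close>, 1 for \<open>iabs\<close>, 1 for the error of \<open>v\<close>, and 2 for
  approximating \<open>x\<close> on both sides.\<close>

lemma vcondI:
  fixes x a :: "real ^ 'n::enum"
  assumes x: "dist (ratvec_of_code (p (2 * m))) x \<le> (1/2) ^ m" and v: "dist (ratvec_of_code v) a \<le> (1/2) ^ m"
    and neg: "a \<notin> basic_ball (p (4 * i + 1))"
    and pos: "dist x a \<le> dist x (ratvec_of_code (ctr (p (4 * i + 3)))) + \<bar>rval (rad (p (4 * i + 3)))\<bar>"
  shows "vcond (CARD('n)) p m v i"
proof -
  let ?n = "CARD('n)" and ?e = "p (4 * i + 3)" and ?x = "ratvec_of_code (p (2 * m)) :: real ^ 'n::enum"
    and ?v = "ratvec_of_code v :: real ^ 'n::enum"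
  define \<epsilon> where "\<epsilon> = (1/2 :: real) ^ m"
  have "dist ?x ?v \<le> dist x a + 2 * \<epsilon>"
    using dist_triangle[of ?x ?v x] dist_triangle[of x ?v a] x v by (simp add: dist_commute \<epsilon>_def)
  moreover have "dist x (ratvec_of_code (ctr ?e)) \<le> dist ?x (ratvec_of_code (ctr ?e)) + \<epsilon>"
    using dist_triangle[of x "ratvec_of_code (ctr ?e)" ?x] x by (simp add: dist_commute \<epsilon>_def)
  ultimately have "real (idist ?n m (p (2 * m)) v) * \<epsilon> \<le>
    (real (idist ?n m (p (2 * m)) (ctr ?e)) + real (iabs m (rad ?e)) + (4 * real ?n + 6)) * \<epsilon>"
    using pos idist_scaled(1)[where 'n='n, of m "p (2 * m)" v] idist_scaled(2)[where 'n='n, of "p (2 * m)" "ctr ?e" m]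
      iabs_scaled(2)[of "rad ?e" m] unfolding \<epsilon>_def[symmetric] by (simp add: algebra_simps)
  then have "real (idist ?n m (p (2 * m)) v) \<le>
    real (idist ?n m (p (2 * m)) (ctr ?e) + iabs m (rad ?e) + (4 * ?n + 6))"
    by (subst (asm) mult_le_cancel_right_pos) (simp_all add: \<epsilon>_def)
  then show ?thesis unfolding vcond_def of_nat_le_iff using iabs_le_idistI[OF neg v] by blast
qed

text \<open>In the second bound, the tolerance \<open>4n + 6\<close> and two more
  \<open>idist\<close> errors give \<open>8n + 8\<close>; returning from the approximation to
  \<open>x\<close> itself adds 2.\<close>

lemma vcondD:
  fixes x :: "real ^ 'n::enum"
  assumes "vcond (CARD('n)) p m v i" and x: "dist (ratvec_of_code (p (2 * m))) x \<le> (1/2) ^ m"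
  shows "\<bar>rval (rad (p (4 * i + 1)))\<bar> \<le> dist (ratvec_of_code v :: real ^ 'n::enum) (ratvec_of_code (ctr (p (4 * i + 1))))
      + (4 * real (CARD('n)) + 4) * (1/2) ^ m"
    and "dist x (ratvec_of_code v) \<le> dist x (ratvec_of_code (ctr (p (4 * i + 3)))) + \<bar>rval (rad (p (4 * i + 3)))\<bar>
      + (8 * real (CARD('n)) + 10) * (1/2) ^ m"
proof -
  let ?n = "CARD('n)" and ?e = "p (4 * i + 3)" and ?x = "ratvec_of_code (p (2 * m)) :: real ^ 'n::enum"
    and ?v = "ratvec_of_code v :: real ^ 'n::enum"
  show "\<bar>rval (rad (p (4 * i + 1)))\<bar> \<le> dist ?v (ratvec_of_code (ctr (p (4 * i + 1)))) + (4 * real ?n + 4) * (1/2) ^ m"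
    using assms(1) by (intro iabs_le_idistD) (simp add: vcond_def)
  define \<epsilon> where "\<epsilon> = (1/2 :: real) ^ m"
  have "idist ?n m (p (2 * m)) v \<le> idist ?n m (p (2 * m)) (ctr ?e) + iabs m (rad ?e) + (4 * ?n + 6)"
    using assms(1) by (simp add: vcond_def)
  from scale_le[OF this, of m]
  have "dist ?x ?v \<le> dist ?x (ratvec_of_code (ctr ?e)) + \<bar>rval (rad ?e)\<bar> + (8 * real ?n + 8) * \<epsilon>"
    using idist_scaled(2)[where 'n='n, of "p (2 * m)" v m] idist_scaled(1)[where 'n='n, of m "p (2 * m)" "ctr ?e"]
      iabs_scaled(1)[of m "rad ?e"] unfolding \<epsilon>_def[symmetric] by (simp add: algebra_simps)
  then show "dist x ?v \<le> dist x (ratvec_of_code (ctr ?e)) + \<bar>rval (rad ?e)\<bar> + (8 * real ?n + 10) * (1/2) ^ m"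
    using dist_triangle[of x ?v ?x] dist_triangle[of ?x "ratvec_of_code (ctr ?e)" x] x
    unfolding \<epsilon>_def[symmetric] by (simp add: dist_commute algebra_simps)
qed

lemma closeI:
  assumes "dist (ratvec_of_code v :: real ^ 'n::enum) (ratvec_of_code v') \<le> (1/2) ^ (m + 1)"
  shows "close (CARD('n)) m v v'"
proof -
  let ?n = "CARD('n)"
  define l where "l = m + 2 * ?n + 3"
  have "(1/2 :: real) ^ (m + 1) = 2 ^ (2 * ?n + 2) * (1/2) ^ l"
    by (simp add: l_def power_add power_one_over field_simps)
  then have "real (idist ?n l v v') * (1/2) ^ l \<le> (2 ^ (2 * ?n + 2) + (2 * real ?n + 1)) * (1/2) ^ l"
    using idist_scaled(1)[where 'n='n, of l v v'] assms by (simp only: distrib_right)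
  then have "real (idist ?n l v v') \<le> real (2 ^ (2 * ?n + 2) + (2 * ?n + 1))"
    by (subst (asm) mult_le_cancel_right_pos) simp_all
  then show ?thesis unfolding close_def l_def by (simp only: of_nat_le_iff)
qed

lemma closeD:
  assumes "close (CARD('n)) m v v'"
  shows "dist (ratvec_of_code v :: real ^ 'n::enum) (ratvec_of_code v') \<le> (1/2) ^ m"
proof -
  let ?n = "CARD('n)"
  define l where "l = m + 2 * ?n + 3"
  have "real (idist ?n l v v') * (1/2) ^ l \<le> real (2 ^ (2 * ?n + 2) + (2 * ?n + 1)) * (1/2) ^ l"
    using assms unfolding close_def l_def by (rule scale_le)
  then have "dist (ratvec_of_code v :: real ^ 'n::enum) (ratvec_of_code v') \<le> (2 ^ (2 * ?n + 2) + (4 * real ?n + 2)) * (1/2) ^ l"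
    using idist_scaled(2)[where 'n='n, of v v' l] by (simp add: algebra_simps)
  also have "\<dots> \<le> 2 ^ (2 * ?n + 3) * (1/2) ^ l"
  proof (rule mult_right_mono)
    have "real (Suc (2 * ?n)) \<le> 2 ^ Suc (2 * ?n)" using of_nat_less_two_power[of "Suc (2 * ?n)", where 'a=real] by linarith
    then show "2 ^ (2 * ?n + 2) + (4 * real ?n + 2) \<le> 2 ^ (2 * ?n + 3)" by (simp add: power_add)
  qed simp
  also have "\<dots> = (1/2) ^ m" by (simp add: l_def power_add power_one_over)
  finally show ?thesis .
qed

lemma total_rep_SomeD:
  assumes "total_rep p = Some A"
  shows "neg_rep (\<lambda>i. p (2 * i)) = Some A" "pos_rep (\<lambda>i. p (2 * i + 1)) = Some A"
proof -
  obtain B where "pair_rep neg_rep pos_rep p = Some (A, B)" "A = B"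
    using assms by (auto simp: total_rep_def split: option.splits if_splits)
  then show "neg_rep (\<lambda>i. p (2 * i)) = Some A" "pos_rep (\<lambda>i. p (2 * i + 1)) = Some A"
    using pair_rep_SomeD by metis+
qed

lemma ratvec_of_code_0: "ratvec_of_code 0 = 0"
  by (simp add: ratvec_of_code_def vec_eq_iff)

section \<open>Projection points and paths of the tree\<close>

context
  fixes p :: baire and x :: "real ^ 'n::enum" and A :: "(real ^ 'n::enum) set"
  assumes p: "pair_rep rho_Rn total_rep p = Some (x, A)" and ne: "A \<noteq> {}"
begin

lemma name_dist: "dist (ratvec_of_code (p (2 * k))) x \<le> (1/2) ^ k"
  using cauchy_rep_SomeD(2)[of ratvec_of_code "\<lambda>i. p (2 * i)" x k] pair_rep_SomeD(1)[OF p]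
  by (simp add: rho_Rn_def)

lemma neg_info: "neg_rep (\<lambda>i. p (4 * i + 1)) = Some A" and pos_info: "pos_rep (\<lambda>i. p (4 * i + 3)) = Some A"
  using total_rep_SomeD[OF pair_rep_SomeD(2)[OF p]] by (simp_all add: algebra_simps numeral_3_eq_3)

text \<open>The first ball of the positive name already bounds \<open>dist x a\<close>. Everything
  is evaluated at precision 0, and \<open>4n + 5\<close> pays for two \<open>idist\<close>
  roundings, one \<open>iabs\<close> rounding and two replacements of \<open>x\<close> by its first
  approximation.\<close>

lemma proj_le_pbound:
  assumes "dist x a = infdist x A"
  shows "norm a \<le> real (pbound (CARD('n)) p)"
proof -
  let ?n = "CARD('n)" and ?x = "ratvec_of_code (p 0) :: real ^ 'n::enum" and ?c = "ratvec_of_code (ctr (p 3)) :: real ^ 'n::enum"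
  have "norm a \<le> norm x + dist x a" using dist_triangle[of 0 a x] by simp
  moreover have "norm x \<le> norm ?x + 1" using dist_triangle[of 0 x ?x] name_dist[of 0] by simp
  moreover have "dist x a \<le> dist x ?c + \<bar>rval (rad (p 3))\<bar>"
    using pos_rep_lower(1)[OF pos_info, of x 0] assms by simp
  moreover have "dist x ?c \<le> dist ?x ?c + 1" using dist_triangle[of x ?c ?x] name_dist[of 0] by (simp add: dist_commute)
  moreover have "norm ?x \<le> real (idist ?n 0 0 (p 0)) + (2 * real ?n + 1)"
    using idist_scaled(2)[where 'n='n, of 0 "p 0" 0] by (simp add: ratvec_of_code_0)
  moreover have "dist ?x ?c \<le> real (idist ?n 0 (p 0) (ctr (p 3))) + (2 * real ?n + 1)"
    using idist_scaled(2)[where 'n='n, of "p 0" "ctr (p 3)" 0] by simp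
  moreover have "\<bar>rval (rad (p 3))\<bar> \<le> real (iabs 0 (rad (p 3))) + 1" using iabs_scaled(2)[of "rad (p 3)" 0] by simp
  ultimately have "norm a \<le> real (idist ?n 0 0 (p 0)) + real (idist ?n 0 (p 0) (ctr (p 3))) + real (iabs 0 (rad (p 3))) + (4 * real ?n + 5)"
    by linarith
  then show ?thesis by (simp add: pbound_def)
qed

text \<open>The tests err only in favour of acceptance, so the rounded name of a true projection
  point is never refuted; its prefixes make the tree infinite.\<close>

lemma node_vname:
  assumes a: "a \<in> A" "dist x a = infdist x A"
  shows "node (CARD('n)) p (uenc (vname a)) L"
proof -
  let ?n = "CARD('n)" and ?u = "vname a"
  note inf = uenc_infinite[of ?u]
  have "blen (uenc ?u) L m \<le> vbound ?n (m + 2 + ?n) (pbound ?n p)" for m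
  proof -
    have "blen (uenc ?u) L m \<le> ?u m" using blen_le_udec[OF inf, of L m] by (simp add: udec_uenc)
    also have "\<dots> \<le> vbound ?n (m + 2 + ?n) (pbound ?n p)" unfolding vname_def
      by (rule vcode_le) (use component_le_norm_cart proj_le_pbound[OF a(2)] order_trans in blast)
    finally show ?thesis .
  qed
  moreover have "blen (uenc ?u) L m = ?u m" if "m < zcount (uenc ?u) L" for m
    using blen_eq_udec[OF inf that] by (simp add: udec_uenc)
  moreover have "vcond ?n p m (?u m) i" for m i
  proof (rule vcondI[of p m x "?u m" a i, OF name_dist])
    have "(1/2 :: real) ^ (m + 2) \<le> (1/2) ^ m" by (rule power_decreasing) auto
    then show "dist (ratvec_of_code (vname a m)) a \<le> (1/2) ^ m" using vname_dist[of a m] by linarith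
    show "a \<notin> basic_ball (p (4 * i + 1))" using neg_rep_SomeD(1)[OF neg_info] a(1) by blast
    show "dist x a \<le> dist x (ratvec_of_code (ctr (p (4 * i + 3)))) + \<bar>rval (rad (p (4 * i + 3)))\<bar>"
      using pos_rep_lower(1)[OF pos_info] a(2) by simp
  qed
  moreover have "close ?n m (?u m) (?u m')" if "m \<le> m'" for m m'
    by (rule closeI[OF vname_cauchy[OF that]])
  ultimately show ?thesis unfolding node_def by simp
qed

lemma infinite_ptree: "infinite (ptree (CARD('n)) p)"
proof -
  obtain a where a: "a \<in> A" "dist x a = infdist x A"
    using proj_points_ex[OF neg_rep_SomeD(2)[OF neg_info] ne] by blast
  have "L \<in> length ` ptree (CARD('n)) p" for L
  proof
    let ?w = "map (\<lambda>i. uenc (vname a) i \<noteq> 0) [0..<L]"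
    show "L = length ?w" by simp
    show "?w \<in> ptree (CARD('n)) p" unfolding ptree_def mem_Collect_eq length_map length_upt diff_zero
      by (rule node_cong[THEN iffD1, OF _ node_vname[OF a]]) simp
  qed
  then have "length ` ptree (CARD('n)) p = UNIV" by blast
  then show ?thesis using finite_imageI[of "ptree (CARD('n)) p" length] by auto
qed

text \<open>On a path every block is eventually tested against every ball, so the limit meets all
  constraints exactly.\<close>

lemma path_proj:
  assumes node: "\<And>L. node (CARD('n)) p \<beta> L"
  shows "\<exists>\<^sub>\<infinity>i. \<beta> i = 0"
    and "\<exists>y. rho_Rn (udec \<beta>) = Some y \<and> y \<in> proj_points (x, A)"
proof -
  let ?n = "CARD('n)"
  show inf: "\<exists>\<^sub>\<infinity>i. \<beta> i = 0"
  proof (rule infinite_zeros)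
    fix L m assume "m \<le> zcount \<beta> L"
    then show "blen \<beta> L m \<le> vbound ?n (m + 2 + ?n) (pbound ?n p)"
      using node[of L] unfolding node_def by (simp only: less_Suc_eq_le)
  qed
  define u where "u = udec \<beta>"
  have u: "blen \<beta> L m = u m" if "zstart \<beta> (Suc m) \<le> L" for m L
    using blen_eq_udec[OF inf] zcount_less_iff[OF inf] that by (simp add: u_def)
  have cond: "vcond ?n p m (u m) i" for m i
  proof -
    \<comment> \<open>Long enough to complete block \<open>m\<close> and to include ball
      \<open>i\<close> among those tested.\<close>
    let ?L = "max (zstart \<beta> (Suc m)) (Suc i)"
    have "m < zcount \<beta> ?L" "i < ?L" by (simp_all add: zcount_less_iff[OF inf])
    then have "vcond ?n p m (blen \<beta> ?L m) i" using node[of ?L] unfolding node_def by blast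
    then show ?thesis using u[of m ?L] by simp
  qed
  have cl: "dist (ratvec_of_code (u i) :: real ^ 'n::enum) (ratvec_of_code (u j)) \<le> (1/2) ^ i" if "i \<le> j" for i j
  proof (rule closeD)
    let ?L = "max (zstart \<beta> (Suc i)) (zstart \<beta> (Suc j))"
    have "i < zcount \<beta> ?L" "j < zcount \<beta> ?L" by (simp_all add: zcount_less_iff[OF inf])
    then have "close ?n i (blen \<beta> ?L i) (blen \<beta> ?L j)" using node[of ?L] that unfolding node_def by blast
    then show "close ?n i (u i) (u j)" using u[of i ?L] u[of j ?L] by simp
  qed
  obtain y where y: "(\<lambda>i. ratvec_of_code (u i)) \<longlonglongrightarrow> (y :: real ^ 'n::enum)" "cauchy_rep ratvec_of_code u = Some y"
    using cauchy_rep_limit[of ratvec_of_code u] cl by blast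
  have "y \<in> proj_points (x, A)"
  proof (rule proj_points_neg[OF _ _ neg_rep_SomeD(1)[OF neg_info]])
    show "\<bar>rval (rad (p (4 * i + 1)))\<bar> \<le> dist y (ratvec_of_code (ctr (p (4 * i + 1))))" for i
    proof (rule limit_le[OF tendsto_const tendsto_dist[OF y(1) tendsto_const] strict_mono_id, of 0])
      show "\<bar>rval (rad (p (4 * i + 1)))\<bar> \<le> dist (ratvec_of_code (u k) :: real ^ 'n::enum) (ratvec_of_code (ctr (p (4 * i + 1))))
          + (4 * real ?n + 4) * (1/2) ^ id k" for k
        unfolding id_apply by (rule vcondD(1)[OF cond[of k i] name_dist[of k]])
    qed
    have *: "dist x y \<le> dist x (ratvec_of_code (ctr (p (4 * i + 3)))) + \<bar>rval (rad (p (4 * i + 3)))\<bar>" for i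
    proof (rule limit_le[OF tendsto_dist[OF tendsto_const y(1)] tendsto_const strict_mono_id, of 0])
      show "dist x (ratvec_of_code (u k)) \<le> dist x (ratvec_of_code (ctr (p (4 * i + 3)))) + \<bar>rval (rad (p (4 * i + 3)))\<bar>
          + (8 * real ?n + 10) * (1/2) ^ id k" for k
        unfolding id_apply by (rule vcondD(2)[OF cond[of k i] name_dist[of k]])
    qed
    obtain a where a: "a \<in> A" "dist x a = infdist x A"
      using proj_points_ex[OF neg_rep_SomeD(2)[OF neg_info] ne] by blast
    \<comment> \<open>Small balls near a nearest point \<open>a\<close> make the upper bounds
      \<open>dist x c + r\<close> approach \<open>infdist x A\<close>.\<close>
    show "dist x y \<le> infdist x A"
    proof (rule field_le_epsilon)
      fix \<eta> :: real assume "0 < \<eta>"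
      then obtain i where "dist x (ratvec_of_code (ctr (p (4 * i + 3)))) + 2 * \<bar>rval (rad (p (4 * i + 3)))\<bar> \<le> dist x a + \<eta>"
        using pos_rep_upper[OF pos_info a(1)] by metis
      then show "dist x y \<le> infdist x A + \<eta>" using *[of i] a(2) by linarith
    qed
  qed
  then show "\<exists>y. rho_Rn (udec \<beta>) = Some y \<and> y \<in> proj_points (x, A)"
    using y(2) by (auto simp: rho_Rn_def u_def)
qed

end

lemma proj_total_le_WKL:
  "strong_weihrauch_le (pair_rep (rho_Rn :: baire \<Rightarrow> (real ^ 'n::enum) option) total_rep) rho_Rn proj_dom proj_points
     tree_rep cantor_rep WKL_dom WKL_val"
proof -
  let ?n = "CARD('n)"
  define K where "K p c = (of_bool (node ?n p (lnth c) (llen c)) :: nat)" for p c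
  define Z where "Z = {\<beta> :: baire. \<exists>\<^sub>\<infinity>i. \<beta> i = 0}"
  have Kc: "computable_partial (\<lambda>p. Some (K p))"
    using computable_partial_comp_rel[of UNIV K] cr_node[of UNIV ?n] by (simp add: K_def)
  have "comp_rel prefix_code Z 1 (\<lambda>\<beta> xs. udec \<beta> (xs ! 0))"
    by (rule cr_udec) (auto intro!: cr_intros simp: Z_def)
  then have Hc: "computable_partial (\<lambda>\<beta>. if \<beta> \<in> Z then Some (udec \<beta>) else None)"
    by (rule computable_partial_comp_rel)
  show ?thesis unfolding strong_weihrauch_le_def
  proof (intro exI conjI allI impI)
    show "computable_partial (\<lambda>\<beta>. if \<beta> \<in> Z then Some (udec \<beta>) else None)" by (rule Hc)
    show "computable_partial (\<lambda>p. Some (K p))" by (rule Kc)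
    fix G assume G: "is_realizer tree_rep cantor_rep WKL_dom WKL_val G"
    show "is_realizer (pair_rep (rho_Rn :: baire \<Rightarrow> (real ^ 'n::enum) option) total_rep) rho_Rn proj_dom proj_points
      (\<lambda>p. Option.bind (Some (K p)) (\<lambda>r. Option.bind (G r) (\<lambda>\<beta>. if \<beta> \<in> Z then Some (udec \<beta>) else None)))"
      unfolding is_realizer_def
    proof (intro allI impI)
      fix p and xA :: "(real ^ 'n::enum) \<times> (real ^ 'n::enum) set"
      assume "pair_rep rho_Rn total_rep p = Some xA" "xA \<in> proj_dom"
      then obtain x A where xA: "xA = (x, A)" "pair_rep rho_Rn total_rep p = Some (x, A)" "A \<noteq> {}"
        by (cases xA) (auto simp: proj_dom_def)
      have "tree_rep (K p) = Some (ptree ?n p)" unfolding K_def by (rule tree_rep_ptree)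
      moreover have "ptree ?n p \<in> WKL_dom"
        using is_tree_ptree infinite_ptree[OF xA(2,3)] by (simp add: WKL_dom_def)
      ultimately obtain \<beta> f where \<beta>: "G (K p) = Some \<beta>" "cantor_rep \<beta> = Some f" "f \<in> WKL_val (ptree ?n p)"
        using G unfolding is_realizer_def by blast
      have f: "\<beta> i \<le> 1" "f i \<longleftrightarrow> \<beta> i = 1" for i
        using \<beta>(2) by (auto simp: cantor_rep_def split: if_splits)
      have node: "node ?n p \<beta> L" for L
      proof -
        have "node ?n p (\<lambda>i. of_bool (map f [0..<L] ! i)) (length (map f [0..<L]))"
          using \<beta>(3) unfolding WKL_val_def ptree_def by blast
        then show ?thesis unfolding length_map length_upt diff_zero
          by (rule node_cong[THEN iffD1, rotated]) (use f in \<open>auto simp: le_Suc_eq\<close>)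
      qed
      have "\<beta> \<in> Z" unfolding Z_def using path_proj(1)[OF xA(2,3) node] by simp
      then show "\<exists>q y. Option.bind (Some (K p)) (\<lambda>r. Option.bind (G r)
          (\<lambda>\<beta>. if \<beta> \<in> Z then Some (udec \<beta>) else None)) = Some q \<and> rho_Rn q = Some y \<and> y \<in> proj_points xA"
        using path_proj(2)[OF xA(2,3) node] \<beta>(1) xA(1) by simp
    qed
  qed
qed

theorem theorem4p7:
  shows "strong_weihrauch_le
           (pair_rep (rho_Rn :: baire \<Rightarrow> (real ^ 'n::enum) option) neg_rep) rho_Rn proj_dom proj_points
           (seq_rep rho_R) rho_R BWT_dom BWT_val
       \<and> strong_weihrauch_le
           (pair_rep (rho_Rn :: baire \<Rightarrow> (real ^ 'n::enum) option) pos_rep) rho_Rn proj_dom proj_points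
           (seq_rep rho_R) rho_R BWT_dom BWT_val
       \<and> strong_weihrauch_le
           (pair_rep (rho_Rn :: baire \<Rightarrow> (real ^ 'n::enum) option) total_rep) rho_Rn proj_dom proj_points
           tree_rep cantor_rep WKL_dom WKL_val"
  using proj_neg_le_BWT proj_pos_le_BWT proj_total_le_WKL by blast

end
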